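(* There exist constants $c,C>0$ such that the following holds. Consider the model $Y=X\beta^*+W$ with parameters $n,p,k,\sigma^2$, where $k\le p/3$, $\sigma^2\le c\min\left\{k,\frac{\log p}{\log\log p}\right\}$, $n\ge C k\log p$, and $\beta^*\in\mathbb R^p$ has exactly $k$ non-zero coordinates and satisfies $|\beta^*|_{\min}\ge 1$. Then w.h.p. as $k\to+\infty$ the regression problem $(X,W,\beta^* )$ does not satisfy the Overlap Gap Property. That is, for every pair of constants $0<\zeta_1<\zeta_2<1$ (not depending on $n,p,k,\sigma^2$ or on $X,W$), w.h.p. as $k\to+\infty$ there is no $r>0$ for which the Overlap Gap Property holds with $(r,\zeta_1,\zeta_2)$.
   Context: Model: $n,p,k$ are positive integers and $\sigma>0$; $X\in\mathbb R^{n\times p}$ has i.i.d. $N(0,1)$ entries, $W\in\mathbb R^n$ has i.i.d. $N(0,\sigma^2)$ entries, $X$ and $W$ are independent, $\beta^*\in\mathbb R^p$ is deterministic and $Y=X\beta^*+W$. $\log$ is the natural logarithm. $\mathrm{Support}(\beta)=\{i:\beta_i\ne0\}$; $\beta$ is $k$-sparse if $|\mathrm{Support}(\beta)|\le k$; $|\beta|_{\min}:=\min\{|\beta_i|:\beta_i\neq0\}$. Overlap Gap Property (OGP): for a fixed instance of $X,W$, the regression problem $(X,W,\beta^* )$ satisfies the OGP with $(r,\zeta_1,\zeta_2)$, where $r>0$ (possibly depending on the parameters) and $0<\zeta_1<\zeta_2<1$ are constants, if (1) $\|Y-X\beta^*\|_2<r$; (2) there exists a $k$-sparse $\beta$ with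 $\mathrm{Support}(\beta)\cap\mathrm{Support}(\beta^* )=\emptyset$ and $\|Y-X\beta\|_2<r$; (3) every $k$-sparse $\beta$ with $\|Y-X\beta\|_2<r$ satisfies either $|\mathrm{Support}(\beta)\cap\mathrm{Support}(\beta^* )|<\zeta_1k$ or $|\mathrm{Support}(\beta)\cap\mathrm{Support}(\beta^* )|>\zeta_2k$. "W.h.p. as $k\to+\infty$" means: for every $\varepsilon>0$ there is $k_0$ (here possibly depending on $\zeta_1,\zeta_2$) such that for all choices of the parameters ($n,p,k,\sigma^2,\beta^*$) satisfying the hypotheses with $k\ge k_0$, the stated event has probability at least $1-\varepsilon$. *)

theory Defs
  imports "HOL-Probability.Probability"
begin

text \<open>
  The dimensions are quantified inside the theorem, so a vector in \<open>\<real>\<^sup>m\<close> is a function on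
  \<open>nat\<close> of which only the coordinates in \<open>{..<m}\<close> are used, and a matrix in \<open>\<real>\<^sup>n\<^sup>\<times>\<^sup>p\<close> is a
  function on pairs of which only the entries in \<open>{..<n} \<times> {..<p}\<close> are used. The Euclidean norm
  on \<open>\<real>\<^sup>n\<close> is \<^term>\<open>\<lambda>v. L2_set v {..<n}\<close>.
\<close>

definition mat_vec :: "nat \<Rightarrow> (nat \<times> nat \<Rightarrow> real) \<Rightarrow> (nat \<Rightarrow> real) \<Rightarrow> nat \<Rightarrow> real" where
  "mat_vec p X \<beta> i = (\<Sum>j<p. X (i, j) * \<beta> j)"

definition support :: "nat \<Rightarrow> (nat \<Rightarrow> real) \<Rightarrow> nat set" where
  "support p \<beta> = {i. i < p \<and> \<beta> i \<noteq> 0}"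

definition sparse :: "nat \<Rightarrow> nat \<Rightarrow> (nat \<Rightarrow> real) \<Rightarrow> bool" where
  "sparse p k \<beta> \<longleftrightarrow> card (support p \<beta>) \<le> k"

text \<open>Only meaningful for vectors with nonempty support.\<close>

definition abs_min :: "nat \<Rightarrow> (nat \<Rightarrow> real) \<Rightarrow> real" where
  "abs_min p \<beta> = Min {\<bar>\<beta> i\<bar> | i. i < p \<and> \<beta> i \<noteq> 0}"

definition response ::
  "nat \<Rightarrow> (nat \<times> nat \<Rightarrow> real) \<Rightarrow> (nat \<Rightarrow> real) \<Rightarrow> (nat \<Rightarrow> real) \<Rightarrow> nat \<Rightarrow> real" where
  "response p X W \<beta>s i = mat_vec p X \<beta>s i + W i"

text \<open>\<open>residual n p X Y \<beta>\<close> is \<open>\<parallel>Y - X\<beta>\<parallel>\<^sub>2\<close>.\<close>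

definition residual ::
  "nat \<Rightarrow> nat \<Rightarrow> (nat \<times> nat \<Rightarrow> real) \<Rightarrow> (nat \<Rightarrow> real) \<Rightarrow> (nat \<Rightarrow> real) \<Rightarrow> real" where
  "residual n p X Y \<beta> = L2_set (\<lambda>i. Y i - mat_vec p X \<beta> i) {..<n}"

definition overlap :: "nat \<Rightarrow> (nat \<Rightarrow> real) \<Rightarrow> (nat \<Rightarrow> real) \<Rightarrow> nat" where
  "overlap p \<beta> \<beta>' = card (support p \<beta> \<inter> support p \<beta>')"

text \<open>The side conditions \<open>0 < r\<close> and \<open>0 < \<zeta>\<^sub>1 < \<zeta>\<^sub>2 < 1\<close> are imposed where this is used.\<close>

definition overlap_gap_property ::
  "nat \<Rightarrow> nat \<Rightarrow> nat \<Rightarrow> (nat \<times> nat \<Rightarrow> real) \<Rightarrow> (nat \<Rightarrow> real) \<Rightarrow> (nat \<Rightarrow> real) \<Rightarrow>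
    real \<Rightarrow> real \<Rightarrow> real \<Rightarrow> bool" where
  "overlap_gap_property n p k X W \<beta>s r \<zeta>\<^sub>1 \<zeta>\<^sub>2 \<longleftrightarrow>
    (let Y = response p X W \<beta>s in
      residual n p X Y \<beta>s < r \<and>
      (\<exists>\<beta>. sparse p k \<beta> \<and> support p \<beta> \<inter> support p \<beta>s = {} \<and> residual n p X Y \<beta> < r) \<and>
      (\<forall>\<beta>. sparse p k \<beta> \<and> residual n p X Y \<beta> < r \<longrightarrow>
        real (overlap p \<beta> \<beta>s) < \<zeta>\<^sub>1 * real k \<or> real (overlap p \<beta> \<beta>s) > \<zeta>\<^sub>2 * real k))"

text \<open>
  The joint law of \<open>(X, W)\<close>: all entries independent, those of \<open>X\<close> being \<open>N(0,1)\<close> and those of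
  \<open>W\<close> being \<open>N(0,\<sigma>\<^sup>2)\<close>. The second parameter of \<^const>\<open>normal_density\<close> is the standard deviation.
\<close>

definition model_law ::
  "nat \<Rightarrow> nat \<Rightarrow> real \<Rightarrow> ((nat \<times> nat \<Rightarrow> real) \<times> (nat \<Rightarrow> real)) measure" where
  "model_law n p \<sigma> =
    (\<Pi>\<^sub>M _\<in>{..<n} \<times> {..<p}. density lborel (normal_density 0 1)) \<Otimes>\<^sub>M
    (\<Pi>\<^sub>M _\<in>{..<n}. density lborel (normal_density 0 \<sigma>))"

lemma prob_space_model_law:
  assumes "0 < \<sigma>"
  shows "prob_space (model_law n p \<sigma>)"
  unfolding model_law_def
  using assms by (intro prob_space_pair prob_space_PiM prob_space_normal_density) auto

end

theory Submission
  imports Defs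
begin

text \<open>
  Above the threshold \<open>n \<ge> C k log p\<close> a Gaussian design is nearly an isometry on sparse vectors,
  and for such designs there is no barrier between vectors that miss the support of \<open>\<beta>\<^sup>*\<close> and
  vectors that share part of it. Suppose that \<open>\<beta>\<close> is \<open>k\<close>-sparse, that its support is disjoint from that of
  \<open>\<beta>\<^sup>*\<close>, and that its residual is below \<open>r\<close>. Drop \<open>m\<close> coordinates of \<open>\<beta>\<close> and put \<open>m\<close> coordinates of \<open>\<beta>\<^sup>*\<close>
  in their place. On average over a balanced family of such exchanges, moving from \<open>\<beta>\<close> in the
  direction of \<open>u = \<beta>\<^sup>* - \<beta>\<close> decreases the squared residual to first order by about
  \<open>2 (m / k) n \<parallel>u\<parallel>\<^sup>2\<close>, while the quadratic term costs only about \<open>(m / k) n \<parallel>u\<parallel>\<^sup>2\<close>. So some exchange produces a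
  \<open>k\<close>-sparse vector of overlap exactly \<open>m\<close> with no larger residual (\<open>exchange_step\<close>). Choosing an
  integer \<open>m\<close> between \<open>\<zeta>\<^sub>1 k\<close> and \<open>\<zeta>\<^sub>2 k\<close> refutes the overlap gap property for every \<open>r\<close> at once. Gain
  and cost scale alike in \<open>m\<close>, so a fixed accuracy of the isometry serves all
  \<open>\<zeta>\<^sub>1\<close> and \<open>\<zeta>\<^sub>2\<close>, and \<open>c\<close> and \<open>C\<close> are absolute constants. The noise enters only through its norm: it is negligible
  because \<open>\<parallel>u\<parallel>\<^sup>2 \<ge> k\<close> and \<open>\<sigma>\<^sup>2 \<le> c k\<close>.
  
  The near isometry on \<open>2 k\<close>-sparse vectors (\<open>sparse_upper\<close>, \<open>sparse_lower\<close>) is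
  obtained from finitely many test vectors. Rounding a sparse vector to a grid of mesh
  proportional to its norm divided by \<open>\<surd>k\<close> yields an integer vector whose \<open>\<ell>\<^sub>1\<close> norm is of order \<open>k\<close>
  (\<open>lattice_rounding\<close>), and there are only \<open>exp (O (k log p))\<close> of these
  (\<open>card_l1_lattice_ball\<close>). For each of them \<open>\<parallel>X z\<parallel>\<^sup>2 / \<parallel>z\<parallel>\<^sup>2\<close> has a chi-square distribution with \<open>n\<close> degrees of
  freedom, which concentrates up to probability \<open>exp (- \<Omega>(n))\<close>
  (\<open>sum_squares_normal_tail\<close>, \<open>mat_vec_norm_concentration\<close>), so a union bound
  suffices.
  
  The statement evaluates the probability of an event described by quantifiers over real vectors
  and radii. Its measurability follows by restricting these quantifiers to rationals
  (\<open>overlap_gap_property_iff_rational\<close>, \<open>sets_no_overlap_gap\<close>).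
\<close>

section \<open>Tails of sums of squares of normal variables\<close>

text \<open>
  Multiplying the \<open>N(0, s\<^sup>2)\<close> density by \<open>exp (a x\<^sup>2)\<close> gives a multiple of another
  centred normal density, with variance \<open>t\<^sup>2 = s\<^sup>2 / (1 - 2 a s\<^sup>2)\<close>.
\<close>

lemma nn_integral_exp_square_normal:
  fixes a s :: real
  assumes "0 < s" "2 * a * s\<^sup>2 < 1"
  shows "(\<integral>\<^sup>+x. ennreal (normal_density 0 s x) * ennreal (exp (a * x\<^sup>2)) \<partial>lborel) = ennreal (1 / sqrt (1 - 2 * a * s\<^sup>2))"
proof -
  define q where "q = 1 - 2 * a * s\<^sup>2"
  have q: "0 < q" using assms by (simp add: q_def)
  have aq: "a = (1 - q) / (2 * s\<^sup>2)" using assms(1) by (simp add: q_def field_simps)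
  define t where "t = s / sqrt q"
  have t: "0 < t" using assms q by (simp add: t_def)
  have t2: "t\<^sup>2 = s\<^sup>2 / q" using q by (simp add: t_def power_divide)
  have "normal_density 0 s x * exp (a * x\<^sup>2) = 1 / sqrt q * normal_density 0 t x" for x
  proof -
    have e: "- x\<^sup>2 / (2 * s\<^sup>2) + a * x\<^sup>2 = - x\<^sup>2 / (2 * t\<^sup>2)"
      using assms(1) q unfolding t2 aq by (simp add: divide_simps) (simp add: algebra_simps)
    have "sqrt (2 * pi * s\<^sup>2) = sqrt q * sqrt (2 * pi * t\<^sup>2)"
      using q by (simp add: t2 real_sqrt_mult[symmetric])
    moreover have "exp (- x\<^sup>2 / (2 * s\<^sup>2)) * exp (a * x\<^sup>2) = exp (- x\<^sup>2 / (2 * t\<^sup>2))"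
      by (simp only: exp_add[symmetric] e)
    ultimately show ?thesis
      by (simp add: normal_density_def)
  qed
  then have "(\<integral>\<^sup>+x. ennreal (normal_density 0 s x) * ennreal (exp (a * x\<^sup>2)) \<partial>lborel)
      = (\<integral>\<^sup>+x. ennreal (1 / sqrt q) * ennreal (normal_density 0 t x) \<partial>lborel)"
    using q by (simp add: ennreal_mult'[symmetric] normal_density_nonneg)
  also have "\<dots> = ennreal (1 / sqrt q) * (\<integral>\<^sup>+x. ennreal (normal_density 0 t x) \<partial>lborel)"
    by (rule nn_integral_cmult) simp
  also have "(\<integral>\<^sup>+x. ennreal (normal_density 0 t x) \<partial>lborel) = 1"
    using t by (simp add: nn_integral_eq_integral normal_density_nonneg)
  finally show ?thesis by (simp add: q_def)
qed

text \<open>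
  The second-order bound on the logarithmic moment generating function of \<open>Z\<^sup>2\<close>. It holds for
  both signs of \<open>a\<close>, so that the upper and the lower tail come from a single Chernoff bound.
\<close>

lemma inverse_sqrt_le_exp:
  fixes a :: real
  assumes "\<bar>a\<bar> \<le> 1 / 4"
  shows "1 / sqrt (1 - 2 * a) \<le> exp (a + 4 * a\<^sup>2)"
proof -
  have pos: "0 < 1 - 2 * a" using assms by linarith
  have "- 2 * a - 8 * a\<^sup>2 \<le> ln (1 - 2 * a)"
  proof (cases "0 \<le> a")
    case True
    then show ?thesis using ln_one_minus_pos_lower_bound[of "2 * a"] assms by (simp add: power2_eq_square)
  next
    case False
    then have "- 2 * a - 4 * a\<^sup>2 \<le> ln (1 - 2 * a)"
      using ln_one_plus_pos_lower_bound[of "- 2 * a"] assms by simp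
    then show ?thesis using zero_le_power2[of a] by linarith
  qed
  then have "- a - 4 * a\<^sup>2 \<le> ln (sqrt (1 - 2 * a))"
    using pos by (simp add: ln_sqrt)
  then have "exp (- (a + 4 * a\<^sup>2)) \<le> sqrt (1 - 2 * a)"
    using pos by (simp add: ln_ge_iff)
  then have "inverse (sqrt (1 - 2 * a)) \<le> inverse (exp (- (a + 4 * a\<^sup>2)))"
    by (rule le_imp_inverse_le) simp
  then show ?thesis by (simp only: exp_minus inverse_inverse_eq) (simp only: inverse_eq_divide)
qed

context prob_space
begin

lemma sum_squares_normal_tail:
  fixes a b s :: real
  assumes I: "finite I" and ind: "indep_vars (\<lambda>_. borel) Z I" and s: "0 < s"
    and normal: "\<And>i. i \<in> I \<Longrightarrow> distributed M lborel (Z i) (normal_density 0 s)"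
    and a: "\<bar>a\<bar> \<le> 1 / 4"
  shows "prob {\<omega> \<in> space M. b \<le> a / s\<^sup>2 * (\<Sum>i\<in>I. (Z i \<omega>)\<^sup>2)} \<le> exp (card I * (a + 4 * a\<^sup>2) - b)"
proof -
  define Y where "Y i \<omega> = exp (a / s\<^sup>2 * (Z i \<omega>)\<^sup>2)" for i \<omega>
  have Zm[measurable]: "i \<in> I \<Longrightarrow> random_variable borel (Z i)" for i
    using ind by (auto simp: indep_vars_def)
  have indY: "indep_vars (\<lambda>_. borel) (\<lambda>i \<omega>. ennreal (Y i \<omega>)) I"
    unfolding Y_def by (rule indep_vars_compose2[OF ind]) simp
  have Y1: "(\<integral>\<^sup>+\<omega>. ennreal (Y i \<omega>) \<partial>M) \<le> ennreal (exp (a + 4 * a\<^sup>2))" if "i \<in> I" for i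
  proof -
    have "(\<integral>\<^sup>+\<omega>. ennreal (Y i \<omega>) \<partial>M)
        = (\<integral>\<^sup>+x. ennreal (normal_density 0 s x) * ennreal (exp (a / s\<^sup>2 * x\<^sup>2)) \<partial>lborel)"
      unfolding Y_def by (rule distributed_nn_integral[OF normal[OF that], symmetric]) simp
    also have "\<dots> = ennreal (1 / sqrt (1 - 2 * (a / s\<^sup>2) * s\<^sup>2))"
      using s a by (intro nn_integral_exp_square_normal) auto
    also have "\<dots> \<le> ennreal (exp (a + 4 * a\<^sup>2))"
      using inverse_sqrt_le_exp[OF a] s by (intro ennreal_leI) simp
    finally show ?thesis .
  qed
  have "(\<integral>\<^sup>+\<omega>. ennreal (exp (a / s\<^sup>2 * (\<Sum>i\<in>I. (Z i \<omega>)\<^sup>2))) \<partial>M) = (\<integral>\<^sup>+\<omega>. (\<Prod>i\<in>I. ennreal (Y i \<omega>)) \<partial>M)"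
    using I by (simp add: Y_def sum_distrib_left exp_sum prod_ennreal)
  also have "\<dots> = (\<Prod>i\<in>I. \<integral>\<^sup>+\<omega>. ennreal (Y i \<omega>) \<partial>M)"
    using I indY by (rule indep_vars_nn_integral) simp
  also have "\<dots> \<le> (\<Prod>i\<in>I. ennreal (exp (a + 4 * a\<^sup>2)))"
    by (intro prod_mono_ennreal) (simp add: Y1)
  also have "\<dots> = ennreal (exp (card I * (a + 4 * a\<^sup>2)))"
    by (simp add: ennreal_power exp_of_nat_mult)
  finally have E: "(\<integral>\<^sup>+\<omega>. ennreal (exp (a / s\<^sup>2 * (\<Sum>i\<in>I. (Z i \<omega>)\<^sup>2))) \<partial>M)
      \<le> ennreal (exp (card I * (a + 4 * a\<^sup>2)))" .
  have "emeasure M {\<omega> \<in> space M. b \<le> a / s\<^sup>2 * (\<Sum>i\<in>I. (Z i \<omega>)\<^sup>2)} \<le>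
      ennreal (exp (- 1 * b)) *
      (\<integral>\<^sup>+\<omega>. ennreal (exp (1 * (a / s\<^sup>2 * (\<Sum>i\<in>I. (Z i \<omega>)\<^sup>2)))) * indicator (space M) \<omega> \<partial>M)"
    by (rule Chernoff_ineq_nn_integral_ge) simp_all
  also have "\<dots> = ennreal (exp (- b)) * (\<integral>\<^sup>+\<omega>. ennreal (exp (a / s\<^sup>2 * (\<Sum>i\<in>I. (Z i \<omega>)\<^sup>2))) \<partial>M)"
    by (intro arg_cong2[where f = "(*)"] nn_integral_cong) simp_all
  also have "\<dots> \<le> ennreal (exp (- b)) * ennreal (exp (card I * (a + 4 * a\<^sup>2)))"
    by (intro mult_left_mono E) simp
  also have "\<dots> = ennreal (exp (card I * (a + 4 * a\<^sup>2) - b))"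
    by (simp add: ennreal_mult'[symmetric] exp_add[symmetric])
  finally show ?thesis by (simp add: emeasure_eq_measure)
qed

text \<open>
  In both tails the Chernoff parameter is \<open>a = \<plusminus>\<delta> / 8\<close>, the minimiser of \<open>4 a\<^sup>2 - \<bar>a\<bar> \<delta>\<close>.
\<close>

lemma sum_squares_normal_upper_tail:
  assumes I: "finite I" and ind: "indep_vars (\<lambda>_. borel) Z I" and s: "0 < s"
    and normal: "\<And>i. i \<in> I \<Longrightarrow> distributed M lborel (Z i) (normal_density 0 s)"
    and d: "0 < \<delta>" "\<delta> \<le> 1"
  shows "prob {\<omega> \<in> space M. (1 + \<delta>) * s\<^sup>2 * card I \<le> (\<Sum>i\<in>I. (Z i \<omega>)\<^sup>2)} \<le> exp (- \<delta>\<^sup>2 * card I / 16)"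
proof -
  have "prob {\<omega> \<in> space M. (1 + \<delta>) * s\<^sup>2 * card I \<le> (\<Sum>i\<in>I. (Z i \<omega>)\<^sup>2)} =
    prob {\<omega> \<in> space M. \<delta> / 8 * (1 + \<delta>) * card I \<le> (\<delta> / 8) / s\<^sup>2 * (\<Sum>i\<in>I. (Z i \<omega>)\<^sup>2)}"
  proof (intro arg_cong[where f = prob] Collect_cong conj_cong refl)
    fix \<omega>
    have "\<delta> / 8 * (1 + \<delta>) * card I = (\<delta> / 8) / s\<^sup>2 * ((1 + \<delta>) * s\<^sup>2 * card I)"
      using s by simp
    moreover have "0 < (\<delta> / 8) / s\<^sup>2" using d s by simp
    ultimately show "(1 + \<delta>) * s\<^sup>2 * card I \<le> (\<Sum>i\<in>I. (Z i \<omega>)\<^sup>2) \<longleftrightarrow>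
        \<delta> / 8 * (1 + \<delta>) * card I \<le> (\<delta> / 8) / s\<^sup>2 * (\<Sum>i\<in>I. (Z i \<omega>)\<^sup>2)"
      by (simp only: mult_le_cancel_left_pos)
  qed
  also have "\<dots> \<le> exp (card I * (\<delta> / 8 + 4 * (\<delta> / 8)\<^sup>2) - \<delta> / 8 * (1 + \<delta>) * card I)"
    using d by (intro sum_squares_normal_tail I ind s normal) auto
  finally show ?thesis by (simp add: field_simps power2_eq_square)
qed

lemma sum_squares_normal_lower_tail:
  assumes I: "finite I" and ind: "indep_vars (\<lambda>_. borel) Z I" and s: "0 < s"
    and normal: "\<And>i. i \<in> I \<Longrightarrow> distributed M lborel (Z i) (normal_density 0 s)"
    and d: "0 < \<delta>" "\<delta> \<le> 1"
  shows "prob {\<omega> \<in> space M. (\<Sum>i\<in>I. (Z i \<omega>)\<^sup>2) \<le> (1 - \<delta>) * s\<^sup>2 * card I} \<le> exp (- \<delta>\<^sup>2 * card I / 16)"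
proof -
  have "prob {\<omega> \<in> space M. (\<Sum>i\<in>I. (Z i \<omega>)\<^sup>2) \<le> (1 - \<delta>) * s\<^sup>2 * card I} =
    prob {\<omega> \<in> space M. - \<delta> / 8 * (1 - \<delta>) * card I \<le> (- \<delta> / 8) / s\<^sup>2 * (\<Sum>i\<in>I. (Z i \<omega>)\<^sup>2)}"
  proof (intro arg_cong[where f = prob] Collect_cong conj_cong refl)
    fix \<omega>
    have "- \<delta> / 8 * (1 - \<delta>) * card I = (- \<delta> / 8) / s\<^sup>2 * ((1 - \<delta>) * s\<^sup>2 * card I)"
      using s by simp
    moreover have "(- \<delta> / 8) / s\<^sup>2 < 0" using d s by simp
    ultimately show "(\<Sum>i\<in>I. (Z i \<omega>)\<^sup>2) \<le> (1 - \<delta>) * s\<^sup>2 * card I \<longleftrightarrow>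
        - \<delta> / 8 * (1 - \<delta>) * card I \<le> (- \<delta> / 8) / s\<^sup>2 * (\<Sum>i\<in>I. (Z i \<omega>)\<^sup>2)"
      by (simp only: mult_le_cancel_left_neg)
  qed
  also have "\<dots> \<le> exp (card I * (- \<delta> / 8 + 4 * (- \<delta> / 8)\<^sup>2) - (- \<delta> / 8 * (1 - \<delta>) * card I))"
    using d by (intro sum_squares_normal_tail I ind s normal) auto
  finally show ?thesis by (simp add: field_simps power2_eq_square)
qed

end

section \<open>Counting lattice points in the l1 ball\<close>

text \<open>
  These vectors replace a net of the sphere. Bounding the \<open>\<ell>\<^sub>1\<close> norm, rather than the support
  and the Euclidean norm, makes them easy to count, and the bound does not depend on any
  choice of a support.
\<close>

definition l1_lattice_ball :: "nat \<Rightarrow> nat \<Rightarrow> (nat \<Rightarrow> int) set" where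
  "l1_lattice_ball p L = {z. (\<forall>i\<ge>p. z i = 0) \<and> (\<Sum>i<p. \<bar>z i\<bar>) \<le> int L}"

text \<open>
  A vector of \<open>\<ell>\<^sub>1\<close> norm at most \<open>L\<close> is a sum of \<open>L\<close> vectors, each of which is zero or a signed
  standard basis vector, and there are \<open>2 p + 1\<close> of those.
\<close>

lemma card_l1_lattice_ball:
  "finite (l1_lattice_ball p L) \<and> card (l1_lattice_ball p L) \<le> (2 * p + 1) ^ L"
proof (induction L)
  case 0
  have "l1_lattice_ball p 0 \<subseteq> {\<lambda>_. 0}"
  proof
    fix z assume "z \<in> l1_lattice_ball p 0"
    then have z: "\<forall>i\<ge>p. z i = 0" "(\<Sum>i<p. \<bar>z i\<bar>) \<le> 0" by (auto simp: l1_lattice_ball_def)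
    then have "(\<Sum>i<p. \<bar>z i\<bar>) = 0" by (simp add: sum_nonneg order_antisym)
    then have "\<forall>i<p. z i = 0" by (simp add: sum_nonneg_eq_0_iff)
    then show "z \<in> {\<lambda>_. 0}" using z(1) by (auto simp: fun_eq_iff) (metis not_le)
  qed
  then show ?case using card_mono[of "{\<lambda>_. 0}" "l1_lattice_ball p 0"] by (auto intro: finite_subset)
next
  case (Suc L)
  define E :: "(nat \<Rightarrow> int) set"
    where "E = insert (\<lambda>_. 0) ((\<lambda>(j, c) i. if i = j then c else 0) ` ({..<p} \<times> {1, -1}))"
  have fE: "finite E" by (simp add: E_def)
  have "card E \<le> 2 * p + 1"
  proof -
    have "card ((\<lambda>(j, c) i. if i = j then c else 0 :: int) ` ({..<p} \<times> {1, -1})) \<le> card ({..<p} \<times> {1, -1 :: int})"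
      by (rule card_image_le) simp
    then show ?thesis unfolding E_def by (intro order_trans[OF card_insert_le_m1]) auto
  qed
  have "l1_lattice_ball p (Suc L) \<subseteq> (\<lambda>(z, e) i. z i + e i) ` (l1_lattice_ball p L \<times> E)"
  proof
    fix z assume z: "z \<in> l1_lattice_ball p (Suc L)"
    show "z \<in> (\<lambda>(z, e) i. z i + e i) ` (l1_lattice_ball p L \<times> E)"
    proof (cases "\<exists>j<p. z j \<noteq> 0")
      case False
      then have "z \<in> l1_lattice_ball p L" using z by (auto simp: l1_lattice_ball_def)
      moreover have "(\<lambda>_. 0) \<in> E" by (simp add: E_def)
      ultimately show ?thesis by (intro image_eqI[where x = "(z, \<lambda>_. 0)"]) auto
    next
      case True
      then obtain j where j: "j < p" "z j \<noteq> 0" by auto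
      \<comment> \<open>Split off one unit from a nonzero coordinate.\<close>
      define e where "e = (\<lambda>i. if i = j then sgn (z j) else 0)"
      have "sgn (z j) \<in> {1, -1}" using j by (auto simp: sgn_if)
      then have "e \<in> E" unfolding E_def e_def using j by (intro insertI2 image_eqI[where x = "(j, sgn (z j))"]) auto
      moreover have "(\<lambda>i. z i - e i) \<in> l1_lattice_ball p L"
      proof -
        have "(\<Sum>i<p. \<bar>z i - e i\<bar>) = \<bar>z j - e j\<bar> + (\<Sum>i\<in>{..<p} - {j}. \<bar>z i - e i\<bar>)"
          using j by (intro sum.remove) auto
        also have "(\<Sum>i\<in>{..<p} - {j}. \<bar>z i - e i\<bar>) = (\<Sum>i\<in>{..<p} - {j}. \<bar>z i\<bar>)"
          by (intro sum.cong) (auto simp: e_def)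
        also have "\<bar>z j - e j\<bar> = \<bar>z j\<bar> - 1" using j by (auto simp: e_def sgn_if)
        also have "\<bar>z j\<bar> - 1 + (\<Sum>i\<in>{..<p} - {j}. \<bar>z i\<bar>) = (\<Sum>i<p. \<bar>z i\<bar>) - 1"
          using j by (subst (2) sum.remove[of _ j]) auto
        finally show ?thesis using z j by (auto simp: l1_lattice_ball_def e_def)
      qed
      ultimately show ?thesis by (intro image_eqI[where x = "(\<lambda>i. z i - e i, e)"]) auto
    qed
  qed
  moreover have "card ((\<lambda>(z, e) i. z i + e i) ` (l1_lattice_ball p L \<times> E)) \<le> (2 * p + 1) ^ Suc L"
  proof -
    have "card ((\<lambda>(z, e) i. z i + e i) ` (l1_lattice_ball p L \<times> E)) \<le> card (l1_lattice_ball p L) * card E"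
      using Suc fE by (intro order_trans[OF card_image_le]) (auto simp: card_cartesian_product)
    also have "\<dots> \<le> (2 * p + 1) ^ L * (2 * p + 1)"
      using Suc \<open>card E \<le> 2 * p + 1\<close> by (intro mult_mono) auto
    finally show ?thesis by (simp add: mult.commute)
  qed
  moreover have "finite ((\<lambda>(z, e) i. z i + e i) ` (l1_lattice_ball p L \<times> E))" using Suc fE by simp
  ultimately show ?case by (meson card_mono finite_subset order_trans)
qed

section \<open>Near isometry on sparse vectors\<close>

lemma L2_set_power2: "(L2_set f A)\<^sup>2 = (\<Sum>i\<in>A. (f i)\<^sup>2)"
  by (simp add: L2_set_def sum_nonneg)

text \<open>
  The Frobenius norm bounds the operator norm. The bound is far from sharp, and serves only to
  start the iteration in \<open>sparse_upper\<close> below from some finite constant.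
\<close>

lemma L2_set_mat_vec_le:
  "L2_set (mat_vec p X u) {..<n} \<le> L2_set X ({..<n} \<times> {..<p}) * L2_set u {..<p}"
proof -
  have row: "(mat_vec p X u i)\<^sup>2 \<le> (\<Sum>j<p. (X (i, j))\<^sup>2) * (L2_set u {..<p})\<^sup>2" for i
  proof -
    have "\<bar>mat_vec p X u i\<bar> \<le> (\<Sum>j<p. \<bar>X (i, j)\<bar> * \<bar>u j\<bar>)"
      unfolding mat_vec_def abs_mult[symmetric] by (rule sum_abs)
    also have "\<dots> \<le> L2_set (\<lambda>j. X (i, j)) {..<p} * L2_set u {..<p}"
      by (rule L2_set_mult_ineq)
    finally have "\<bar>mat_vec p X u i\<bar>\<^sup>2 \<le> (L2_set (\<lambda>j. X (i, j)) {..<p} * L2_set u {..<p})\<^sup>2"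
      by (rule power_mono) simp
    then show ?thesis by (simp add: power_mult_distrib L2_set_power2)
  qed
  have "(\<Sum>i<n. (mat_vec p X u i)\<^sup>2) \<le> (\<Sum>i<n. (\<Sum>j<p. (X (i, j))\<^sup>2) * (L2_set u {..<p})\<^sup>2)"
    by (intro sum_mono row)
  also have "\<dots> = (L2_set X ({..<n} \<times> {..<p}) * L2_set u {..<p})\<^sup>2"
    by (simp add: power_mult_distrib L2_set_power2 sum.cartesian_product sum_distrib_right[symmetric])
  finally have "(L2_set (mat_vec p X u) {..<n})\<^sup>2 \<le> \<dots>" by (simp add: L2_set_power2)
  then show ?thesis by (rule power2_le_imp_le) simp
qed

text \<open>
  Rounding \<open>u\<close> towards zero on the grid of mesh \<open>t = \<parallel>u\<parallel> / (20 \<surd>d)\<close>. Each of the at most \<open>d\<close>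
  nonzero coordinates is off by at most \<open>t\<close>, so the error \<open>w\<close> has norm at most
  \<open>t \<surd>d = \<parallel>u\<parallel> / 20\<close>; it vanishes off the support of \<open>u\<close>, hence is as sparse as \<open>u\<close>. Rounding
  towards zero gives \<open>t \<parallel>z\<parallel>\<^sub>2 \<le> \<parallel>u\<parallel>\<close>, and for integer vectors the \<open>\<ell>\<^sub>1\<close> norm is at most the squared
  \<open>\<ell>\<^sub>2\<close> norm, so \<open>\<parallel>z\<parallel>\<^sub>1 \<le> \<parallel>u\<parallel>\<^sup>2 / t\<^sup>2 = 400 d\<close>.
\<close>

lemma lattice_rounding:
  fixes u :: "nat \<Rightarrow> real"
  assumes d: "card (support p u) \<le> d" and u: "0 < L2_set u {..<p}"
  obtains t :: real and z :: "nat \<Rightarrow> int" and w :: "nat \<Rightarrow> real" where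
    "0 < t" "z \<in> l1_lattice_ball p (400 * d)" "\<And>i. i < p \<Longrightarrow> u i = t * z i + w i"
    "support p w \<subseteq> support p u" "L2_set w {..<p} \<le> L2_set u {..<p} / 20"
    "t * L2_set (\<lambda>i. real_of_int (z i)) {..<p} \<le> L2_set u {..<p}"
proof -
  define s where "s = L2_set u {..<p}"
  have s: "0 < s" using u by (simp add: s_def)
  have fin: "finite (support p u)" by (simp add: support_def)
  have "support p u \<noteq> {}"
  proof
    assume "support p u = {}"
    then have "L2_set u {..<p} = 0" by (intro L2_set_0') (auto simp: support_def)
    then show False using u by simp
  qed
  then have dpos: "0 < d" using d fin by (metis card_gt_0_iff less_le_trans)
  define t where "t = s / (20 * sqrt d)"
  have t: "0 < t" using s dpos by (simp add: t_def)
  have t2: "400 * d * t\<^sup>2 = s\<^sup>2" using dpos by (simp add: t_def power_divide power_mult_distrib)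
  define z where "z i = (if i < p then (if 0 \<le> u i then \<lfloor>\<bar>u i\<bar> / t\<rfloor> else - \<lfloor>\<bar>u i\<bar> / t\<rfloor>) else 0)" for i
  define w where "w i = u i - t * z i" for i
  have absz: "\<bar>real_of_int (z i)\<bar> \<le> \<bar>u i\<bar> / t" "\<bar>w i\<bar> \<le> t" if "i < p" for i
  proof -
    have f: "real_of_int \<lfloor>\<bar>u i\<bar> / t\<rfloor> \<le> \<bar>u i\<bar> / t" "\<bar>u i\<bar> / t < real_of_int \<lfloor>\<bar>u i\<bar> / t\<rfloor> + 1"
      "0 \<le> \<lfloor>\<bar>u i\<bar> / t\<rfloor>"
      using t by auto
    have g: "t * real_of_int \<lfloor>\<bar>u i\<bar> / t\<rfloor> \<le> \<bar>u i\<bar>" "\<bar>u i\<bar> \<le> t * real_of_int \<lfloor>\<bar>u i\<bar> / t\<rfloor> + t"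
      using f(1,2) t by (simp_all only: pos_le_divide_eq pos_divide_less_eq mult.commute[of _ t]) (simp add: algebra_simps)
    show "\<bar>real_of_int (z i)\<bar> \<le> \<bar>u i\<bar> / t" using f that by (auto simp: z_def)
    show "\<bar>w i\<bar> \<le> t" using g that by (auto simp: w_def z_def)
  qed
  have tz: "\<bar>t * z i\<bar> \<le> \<bar>u i\<bar>" if "i < p" for i
    using absz(1)[OF that] t by (simp add: field_simps abs_mult)
  have z2: "t * L2_set (\<lambda>i. real_of_int (z i)) {..<p} \<le> s"
  proof -
    have "t * L2_set (\<lambda>i. real_of_int (z i)) {..<p} = L2_set (\<lambda>i. \<bar>t * z i\<bar>) {..<p}"
      using t by (simp add: L2_set_right_distrib) (simp add: L2_set_def)
    also have "\<dots> \<le> L2_set (\<lambda>i. \<bar>u i\<bar>) {..<p}"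
      by (rule L2_set_mono) (auto intro: tz)
    also have "\<dots> = s" by (simp add: s_def L2_set_def)
    finally show ?thesis .
  qed
  have "z \<in> l1_lattice_ball p (400 * d)"
  proof -
    have "real_of_int (\<Sum>i<p. \<bar>z i\<bar>) \<le> (\<Sum>i<p. (real_of_int (z i))\<^sup>2)"
    proof -
      have "(\<Sum>i<p. \<bar>z i\<bar>) \<le> (\<Sum>i<p. (z i)\<^sup>2)"
      proof (rule sum_mono)
        fix i show "\<bar>z i\<bar> \<le> (z i)\<^sup>2"
          using self_le_power[of "\<bar>z i\<bar>" 2] by (cases "z i = 0") auto
      qed
      then show ?thesis by (metis (mono_tags, lifting) of_int_le_iff of_int_power of_int_sum sum.cong)
    qed
    also have "\<dots> \<le> 400 * d"
    proof -
      have "(t * L2_set (\<lambda>i. real_of_int (z i)) {..<p})\<^sup>2 \<le> s\<^sup>2"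
        using z2 t by (intro power_mono) auto
      then have "t\<^sup>2 * (\<Sum>i<p. (real_of_int (z i))\<^sup>2) \<le> t\<^sup>2 * (400 * d)"
        by (simp add: power_mult_distrib L2_set_power2 t2[symmetric] mult_ac)
      then show ?thesis using t by simp
    qed
    finally have "(\<Sum>i<p. \<bar>z i\<bar>) \<le> int (400 * d)" by linarith
    then show ?thesis by (auto simp: l1_lattice_ball_def z_def)
  qed
  moreover have "support p w \<subseteq> support p u"
    by (auto simp: support_def w_def z_def)
  moreover have "L2_set w {..<p} \<le> s / 20"
  proof -
    have "(L2_set w {..<p})\<^sup>2 = (\<Sum>i\<in>support p u. (w i)\<^sup>2)"
      unfolding L2_set_power2
      by (rule sum.mono_neutral_right) (auto simp: support_def w_def z_def)
    also have "\<dots> \<le> (\<Sum>i\<in>support p u. t\<^sup>2)"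
      using absz(2) t by (intro sum_mono) (auto simp: support_def abs_le_square_iff[symmetric])
    also have "\<dots> \<le> d * t\<^sup>2" using d by (simp add: mult_right_mono)
    also have "\<dots> = (s / 20)\<^sup>2" using t2 by (simp add: power_divide)
    finally show ?thesis by (rule power2_le_imp_le) (use s in simp)
  qed
  ultimately show ?thesis using that[OF t, of z w] z2 by (simp add: s_def[symmetric] w_def)
qed

lemma mat_vec_scale_add: 
  assumes "\<And>j. j < p \<Longrightarrow> u j = t * v j + w j"
  shows "mat_vec p X u i = t * mat_vec p X v i + mat_vec p X w i"
proof -
  have "mat_vec p X u i = (\<Sum>j<p. t * (X (i, j) * v j) + X (i, j) * w j)"
    unfolding mat_vec_def by (intro sum.cong) (auto simp: assms algebra_simps)
  then show ?thesis by (simp add: mat_vec_def sum.distrib sum_distrib_left)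
qed

lemma L2_set_triangle_lower:
  "L2_set f A - L2_set g A \<le> L2_set (\<lambda>i. f i + g i) A"
proof -
  have "L2_set f A = L2_set (\<lambda>i. (f i + g i) + (- g i)) A" by simp
  also have "\<dots> \<le> L2_set (\<lambda>i. f i + g i) A + L2_set (\<lambda>i. - g i) A" by (rule L2_set_triangle_ineq)
  also have "L2_set (\<lambda>i. - g i) A = L2_set g A" by (simp add: L2_set_def)
  finally show ?thesis by simp
qed

lemma L2_set_scale: "0 \<le> t \<Longrightarrow> L2_set (\<lambda>i. t * f i) A = t * L2_set f A"
  by (simp add: L2_set_right_distrib)

text \<open>
  The net hypothesis: \<open>X\<close> distorts the norms of all lattice vectors of \<open>\<ell>\<^sub>1\<close> norm at most \<open>400 d\<close>
  by factors close to \<open>N\<close>. The two factors, and the relative accuracy \<open>1 / 20\<close> of the rounding,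
  are chosen so that the constants \<open>h = 21 / 19\<close> and \<open>l = 21 / 25\<close> obtained below for all \<open>d\<close>-sparse
  vectors satisfy \<open>2 l (l - 1 / 10) \<ge> h\<^sup>2\<close>, which is what \<open>exchange_step\<close> requires.
\<close>

locale lattice_near_isometry =
  fixes n p d :: nat and X :: "nat \<times> nat \<Rightarrow> real" and N :: real
  assumes N: "0 \<le> N"
    and upper: "\<And>z. z \<in> l1_lattice_ball p (400 * d) \<Longrightarrow>
      L2_set (mat_vec p X (\<lambda>i. real_of_int (z i))) {..<n}
        \<le> 21 / 20 * N * L2_set (\<lambda>i. real_of_int (z i)) {..<p}"
    and lower: "\<And>z. z \<in> l1_lattice_ball p (400 * d) \<Longrightarrow>
      18 / 19 * N * L2_set (\<lambda>i. real_of_int (z i)) {..<p}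
        \<le> L2_set (mat_vec p X (\<lambda>i. real_of_int (z i))) {..<n}"
begin

text \<open>
  Write \<open>u = t z + w\<close> with \<open>z\<close> in the lattice and \<open>w\<close> again \<open>d\<close>-sparse of norm at most
  \<open>\<parallel>u\<parallel> / 20\<close>. If \<open>\<parallel>X u\<parallel> \<le> c \<parallel>u\<parallel>\<close> holds for all \<open>d\<close>-sparse vectors, then it also holds with
  \<open>21 N / 20 + c / 20\<close> in place of \<open>c\<close>. This map contracts towards its fixed point \<open>21 N / 19\<close>;
  iterate it, starting from a crude bound.
\<close>

lemma sparse_upper:
  assumes "card (support p u) \<le> d"
  shows "L2_set (mat_vec p X u) {..<n} \<le> 21 / 19 * N * L2_set u {..<p}"
proof -
  define B where "B = L2_set X ({..<n} \<times> {..<p})"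
  have "L2_set (mat_vec p X u) {..<n} \<le> (21 / 19 * N + (1 / 20) ^ j * B) * L2_set u {..<p}"
    if "card (support p u) \<le> d" for j u
    using that
  proof (induction j arbitrary: u)
    case 0
    have "B * L2_set u {..<p} \<le> (21 / 19 * N + B) * L2_set u {..<p}"
      using N by (intro mult_right_mono) auto
    then show ?case using L2_set_mat_vec_le[where u = u and X = X and n = n and p = p] by (simp add: B_def)
  next
    case (Suc j)
    show ?case
    proof (cases "0 < L2_set u {..<p}")
      case False
      then have "L2_set u {..<p} = 0" using L2_set_nonneg[of u "{..<p}"] by linarith
      then show ?thesis using L2_set_mat_vec_le[where u = u and X = X and n = n and p = p] by simp
    next
      case True
      obtain t z w where tzw: "0 < t" "z \<in> l1_lattice_ball p (400 * d)"
        "\<And>i. i < p \<Longrightarrow> u i = t * real_of_int (z i) + w i"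
        "support p w \<subseteq> support p u" "L2_set w {..<p} \<le> L2_set u {..<p} / 20"
        "t * L2_set (\<lambda>i. real_of_int (z i)) {..<p} \<le> L2_set u {..<p}"
        using lattice_rounding[OF Suc.prems True] by metis
      have "card (support p w) \<le> d"
        using card_mono[OF _ tzw(4)] Suc.prems by (auto simp: support_def)
      note IH = Suc.IH[OF this]
      have "L2_set (mat_vec p X u) {..<n} =
          L2_set (\<lambda>i. t * mat_vec p X (\<lambda>i. real_of_int (z i)) i + mat_vec p X w i) {..<n}"
        using mat_vec_scale_add[OF tzw(3)] by (intro L2_set_cong) auto
      also have "\<dots> \<le> t * L2_set (mat_vec p X (\<lambda>i. real_of_int (z i))) {..<n} + L2_set (mat_vec p X w) {..<n}"
        using L2_set_triangle_ineq tzw(1) by (metis L2_set_scale less_imp_le)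
      also have "\<dots> \<le> 21 / 20 * N * L2_set u {..<p}
          + (21 / 19 * N + (1 / 20) ^ j * B) * (L2_set u {..<p} / 20)"
      proof (rule add_mono)
        have "t * L2_set (mat_vec p X (\<lambda>i. real_of_int (z i))) {..<n}
            \<le> t * (21 / 20 * N * L2_set (\<lambda>i. real_of_int (z i)) {..<p})"
          using upper[OF tzw(2)] tzw(1) by (intro mult_left_mono) auto
        also have "\<dots> = 21 / 20 * N * (t * L2_set (\<lambda>i. real_of_int (z i)) {..<p})" by simp
        also have "\<dots> \<le> 21 / 20 * N * L2_set u {..<p}" using tzw(6) N by (intro mult_left_mono) auto
        finally show "t * L2_set (mat_vec p X (\<lambda>i. real_of_int (z i))) {..<n} \<le> \<dots>" .
        show "L2_set (mat_vec p X w) {..<n} \<le> (21 / 19 * N + (1 / 20) ^ j * B) * (L2_set u {..<p} / 20)"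
          using N by (intro order_trans[OF IH] mult_left_mono tzw(5)) (auto simp: B_def)
      qed
      also have "\<dots> = (21 / 19 * N + (1 / 20) ^ Suc j * B) * L2_set u {..<p}"
        by (simp add: field_simps)
      finally show ?thesis .
    qed
  qed
  then have "\<forall>j. L2_set (mat_vec p X u) {..<n} \<le> (21 / 19 * N + (1 / 20) ^ j * B) * L2_set u {..<p}"
    using assms by blast
  moreover have "(\<lambda>j. (21 / 19 * N + (1 / 20) ^ j * B) * L2_set u {..<p})
      \<longlonglongrightarrow> (21 / 19 * N + 0 * B) * L2_set u {..<p}"
    by (intro tendsto_intros LIMSEQ_power_zero) auto
  ultimately show ?thesis by (intro LIMSEQ_le_const) auto
qed

text \<open>
  Subtract the upper bound for the rounding error from the lower bound for the lattice part:
  \<open>18 / 19 * (19 / 20) - 21 / 19 * (1 / 20) > 21 / 25\<close>.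
\<close>

lemma sparse_lower:
  assumes "card (support p u) \<le> d"
  shows "21 / 25 * N * L2_set u {..<p} \<le> L2_set (mat_vec p X u) {..<n}"
proof (cases "0 < L2_set u {..<p}")
  case False
  then have "L2_set u {..<p} = 0" using L2_set_nonneg[of u "{..<p}"] by linarith
  then show ?thesis by simp
next
  case True
  let ?s = "L2_set u {..<p}"
  obtain t z w where tzw: "0 < t" "z \<in> l1_lattice_ball p (400 * d)"
    "\<And>i. i < p \<Longrightarrow> u i = t * real_of_int (z i) + w i"
    "support p w \<subseteq> support p u" "L2_set w {..<p} \<le> ?s / 20"
    using lattice_rounding[OF assms True] by metis
  let ?z = "\<lambda>i. real_of_int (z i)"
  have w: "card (support p w) \<le> d"
    using card_mono[OF _ tzw(4)] assms by (auto simp: support_def)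
  have "?s = L2_set (\<lambda>i. t * ?z i + w i) {..<p}" using tzw(3) by (intro L2_set_cong) auto
  also have "\<dots> \<le> t * L2_set ?z {..<p} + L2_set w {..<p}"
    using L2_set_triangle_ineq tzw(1) by (metis L2_set_scale less_imp_le)
  finally have tz: "19 / 20 * ?s \<le> t * L2_set ?z {..<p}" using tzw(5) by simp
  have "t * L2_set (mat_vec p X ?z) {..<n} - L2_set (mat_vec p X w) {..<n}
      \<le> L2_set (\<lambda>i. t * mat_vec p X ?z i + mat_vec p X w i) {..<n}"
    using L2_set_triangle_lower tzw(1) by (metis L2_set_scale less_imp_le)
  also have "\<dots> = L2_set (mat_vec p X u) {..<n}"
    using mat_vec_scale_add[OF tzw(3)] by (intro L2_set_cong) auto
  finally have main: "t * L2_set (mat_vec p X ?z) {..<n} - L2_set (mat_vec p X w) {..<n}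
      \<le> L2_set (mat_vec p X u) {..<n}" .
  have "18 / 19 * N * (19 / 20 * ?s) \<le> 18 / 19 * N * (t * L2_set ?z {..<p})"
    using tz N by (intro mult_left_mono) auto
  also have "\<dots> = t * (18 / 19 * N * L2_set ?z {..<p})" by simp
  also have "\<dots> \<le> t * L2_set (mat_vec p X ?z) {..<n}"
    using lower[OF tzw(2)] tzw(1) by (intro mult_left_mono) auto
  finally have 1: "9 / 10 * (N * ?s) \<le> t * L2_set (mat_vec p X ?z) {..<n}" by simp
  have "L2_set (mat_vec p X w) {..<n} \<le> 21 / 19 * N * (?s / 20)"
    using N by (intro order_trans[OF sparse_upper[OF w]] mult_left_mono tzw(5)) auto
  then have 2: "L2_set (mat_vec p X w) {..<n} \<le> 21 / 380 * (N * ?s)" by simp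
  have "0 \<le> N * ?s" using N by simp
  then show ?thesis using main 1 2 by simp
qed

end

section \<open>Exchanging coordinates\<close>

text \<open>
  Cyclic windows: arrange \<open>A\<close> on a circle and let \<open>T j\<close> consist of the \<open>m\<close> consecutive elements
  starting at position \<open>j\<close>. Every element lies in exactly \<open>m\<close> of these \<open>k\<close> windows, so the family
  averages like a uniformly random \<open>m\<close>-subset, with only \<open>k\<close> sets and no binomial coefficients.
\<close>

lemma balanced_subsets:
  assumes "finite A" "card A = k" "m \<le> k"
  obtains T :: "nat \<Rightarrow> 'a set" where
    "\<And>j. j < k \<Longrightarrow> T j \<subseteq> A" "\<And>j. j < k \<Longrightarrow> card (T j) = m"
    "\<And>g :: 'a \<Rightarrow> real. (\<Sum>j<k. \<Sum>a\<in>T j. g a) = m * (\<Sum>a\<in>A. g a)"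
proof -
  obtain e where e: "bij_betw e {..<k} A"
    using ex_bij_betw_nat_finite[OF assms(1)] assms(2) by (auto simp: lessThan_atLeast0)
  have rot: "bij_betw (\<lambda>l. (j + l) mod k) {..<k} {..<k}" if "j < k" for j
  proof (rule bij_betwI')
    have m: "(j + l) mod k = (if j + l < k then j + l else j + l - k)" if "l < k" for l
      using that \<open>j < k\<close> by (auto simp: le_mod_geq)
    fix x y assume "x \<in> {..<k}" "y \<in> {..<k}"
    then show "((j + x) mod k = (j + y) mod k) = (x = y)" by (auto simp: m split: if_splits)
  next
    fix x show "x \<in> {..<k} \<Longrightarrow> (j + x) mod k \<in> {..<k}" using that by simp
  next
    fix y assume y: "y \<in> {..<k}"
    show "\<exists>x\<in>{..<k}. y = (j + x) mod k"
      using y that by (intro bexI[of _ "(y + (k - j)) mod k"]) (auto simp: mod_add_right_eq)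
  qed
  define T where "T j = (\<lambda>l. e ((j + l) mod k)) ` {..<m}" for j
  have inj: "inj_on (\<lambda>l. e ((j + l) mod k)) {..<m}" if "j < k" for j
  proof -
    have "inj_on (e \<circ> (\<lambda>l. (j + l) mod k)) {..<k}"
      using rot[OF that] e by (intro comp_inj_on) (auto simp: bij_betw_def)
    then show ?thesis using assms(3) by (auto simp: comp_def elim!: inj_on_subset)
  qed
  show ?thesis
  proof (rule that[of T])
    fix j assume j: "j < k"
    show "T j \<subseteq> A"
      using e j by (auto simp: T_def bij_betw_def)
    show "card (T j) = m" using inj[OF j] by (simp add: T_def card_image)
  next
    fix g :: "'a \<Rightarrow> real"
    have "(\<Sum>j<k. \<Sum>a\<in>T j. g a) = (\<Sum>j<k. \<Sum>l<m. g (e ((j + l) mod k)))"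
      by (intro sum.cong) (auto simp: T_def sum.reindex[OF inj])
    also have "\<dots> = (\<Sum>l<m. \<Sum>j<k. g (e ((l + j) mod k)))"
      by (subst sum.swap) (simp add: add.commute)
    also have "\<dots> = (\<Sum>l<m. \<Sum>j<k. g (e j))"
    proof (rule sum.cong)
      fix l assume "l \<in> {..<m}"
      then have "l < k" using assms(3) by simp
      then show "(\<Sum>j<k. g (e ((l + j) mod k))) = (\<Sum>j<k. g (e j))"
        by (rule sum.reindex_bij_betw[OF rot, of _ "\<lambda>j. g (e j)"])
    qed simp
    also have "\<dots> = m * (\<Sum>a\<in>A. g a)"
      by (simp add: sum.reindex_bij_betw[OF e])
    finally show "(\<Sum>j<k. \<Sum>a\<in>T j. g a) = m * (\<Sum>a\<in>A. g a)" .
  qed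
qed

text \<open>
  A vector \<open>\<beta>\<close> that misses the support of \<open>\<beta>\<^sup>*\<close> can be given any overlap \<open>m \<le> k\<close> without increasing the
  residual. Let \<open>u = \<beta>\<^sup>* - \<beta>\<close> and let \<open>y = W + X u\<close> be the residual vector of \<open>\<beta>\<close>. Enlarge the support of
  \<open>\<beta>\<close> to a set \<open>S\<close> of \<open>k\<close> coordinates disjoint from the support \<open>A\<close> of \<open>\<beta>\<^sup>*\<close>. For windows
  \<open>T \<subseteq> A\<close> and \<open>R \<subseteq> S\<close> of size \<open>m\<close> let \<open>v\<close> be the restriction of \<open>u\<close> to \<open>T \<union> R\<close>; then \<open>\<beta> + v\<close>
  agrees with \<open>\<beta>\<^sup>*\<close> on \<open>T\<close> and vanishes on \<open>R\<close>, so it is \<open>k\<close>-sparse with overlap \<open>m\<close>.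
  
  Over the \<open>k\<close> pairs of windows the vectors \<open>v\<close> add up to \<open>m u\<close> and their squared norms to
  \<open>m \<parallel>u\<parallel>\<^sup>2\<close>. Hence the changes \<open>\<parallel>y - X v\<parallel>\<^sup>2 - \<parallel>y\<parallel>\<^sup>2\<close> add up to at most
  \<open>m (h\<^sup>2 N\<^sup>2 \<parallel>u\<parallel>\<^sup>2 - 2 \<langle>y, X u\<rangle>)\<close>. The noise satisfies \<open>\<parallel>W\<parallel> \<le> N \<parallel>u\<parallel> / 10\<close>, because the \<open>k\<close>
  entries of \<open>\<beta>\<^sup>*\<close> of absolute value at least 1 make \<open>\<parallel>u\<parallel> \<ge> \<surd>k\<close>. Cauchy-Schwarz therefore gives
  \<open>\<langle>y, X u\<rangle> \<ge> \<parallel>X u\<parallel> (\<parallel>X u\<parallel> - \<parallel>W\<parallel>) \<ge> l (l - 1 / 10) N\<^sup>2 \<parallel>u\<parallel>\<^sup>2\<close>, the sum is not positive, and some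
  window does not increase the residual. The constants do not involve \<open>m\<close>.
\<close>

lemma exchange_step:
  fixes X :: "nat \<times> nat \<Rightarrow> real" and W \<beta>s \<beta> :: "nat \<Rightarrow> real" and N :: real
  assumes N: "0 \<le> N"
    and upper: "\<And>u. card (support p u) \<le> 2 * k \<Longrightarrow>
      L2_set (mat_vec p X u) {..<n} \<le> 21 / 19 * N * L2_set u {..<p}"
    and lower: "\<And>u. card (support p u) \<le> 2 * k \<Longrightarrow>
      21 / 25 * N * L2_set u {..<p} \<le> L2_set (mat_vec p X u) {..<n}"
    and W: "L2_set W {..<n} \<le> N * sqrt k / 10"
    and \<beta>s: "card (support p \<beta>s) = k" "\<And>i. i \<in> support p \<beta>s \<Longrightarrow> 1 \<le> \<bar>\<beta>s i\<bar>"
    and k: "0 < k" "2 * k \<le> p"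
    and \<beta>: "sparse p k \<beta>" "support p \<beta> \<inter> support p \<beta>s = {}"
    and m: "m \<le> k"
  shows "\<exists>\<beta>'. sparse p k \<beta>' \<and> overlap p \<beta>' \<beta>s = m \<and>
    residual n p X (response p X W \<beta>s) \<beta>' \<le> residual n p X (response p X W \<beta>s) \<beta>"
proof -
  define A where "A = support p \<beta>s"
  have A: "finite A" "card A = k" "A \<subseteq> {..<p}" using \<beta>s by (auto simp: A_def support_def)
  have "k \<le> card ({..<p} - A)" using A k by (simp add: card_Diff_subset)
  moreover have "support p \<beta> \<subseteq> {..<p} - A" using \<beta>(2) by (auto simp: A_def support_def)
  moreover have "card (support p \<beta>) \<le> k" using \<beta>(1) by (simp add: sparse_def)
  ultimately obtain S where S: "support p \<beta> \<subseteq> S" "S \<subseteq> {..<p} - A" "card S = k"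
    using exists_subset_between[of "support p \<beta>" k "{..<p} - A"] by blast
  have finS: "finite S" using S(2) finite_subset by blast
  have disj: "A \<inter> S = {}" using S(2) by auto
  obtain T where T: "\<And>j. j < k \<Longrightarrow> T j \<subseteq> A" "\<And>j. j < k \<Longrightarrow> card (T j) = m"
    "\<And>g :: nat \<Rightarrow> real. (\<Sum>j<k. \<Sum>a\<in>T j. g a) = m * (\<Sum>a\<in>A. g a)"
    using balanced_subsets[OF A(1,2) m] by metis
  obtain R where R: "\<And>j. j < k \<Longrightarrow> R j \<subseteq> S" "\<And>j. j < k \<Longrightarrow> card (R j) = m"
    "\<And>g :: nat \<Rightarrow> real. (\<Sum>j<k. \<Sum>a\<in>R j. g a) = m * (\<Sum>a\<in>S. g a)"
    using balanced_subsets[OF finS S(3) m] by metis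
  define u where "u i = \<beta>s i - \<beta> i" for i
  define v where "v j i = (if i \<in> T j \<union> R j then u i else 0)" for j i
  have \<beta>0: "\<beta> i = 0" if "i < p" "i \<notin> S" for i using that S(1) by (auto simp: support_def)
  have \<beta>s0: "\<beta>s i = 0" if "i < p" "i \<notin> A" for i using that by (auto simp: A_def support_def)
  have TR: "finite (T j)" "finite (R j)" "T j \<inter> R j = {}" "T j \<union> R j \<subseteq> {..<p}" if "j < k" for j
    using T(1)[OF that] R(1)[OF that] A finS disj S(2) by (auto intro: finite_subset)
  have sum_v: "(\<Sum>i<p. f i (v j i)) = (\<Sum>i\<in>T j. f i (u i)) + (\<Sum>i\<in>R j. f i (u i))"
    if "j < k" and "\<And>i. f i 0 = 0" for j and f :: "nat \<Rightarrow> real \<Rightarrow> real"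
  proof -
    have "(\<Sum>i<p. f i (v j i)) = (\<Sum>i\<in>T j \<union> R j. f i (u i))"
      using TR(4)[OF that(1)] that(2) by (intro sum.mono_neutral_cong_right) (auto simp: v_def)
    then show ?thesis using TR[OF that(1)] by (simp add: sum.union_disjoint)
  qed
  have avg: "(\<Sum>j<k. \<Sum>i<p. f i (v j i)) = m * (\<Sum>i<p. f i (u i))"
    if f: "\<And>i. f i 0 = 0" for f :: "nat \<Rightarrow> real \<Rightarrow> real"
  proof -
    have "(\<Sum>j<k. \<Sum>i<p. f i (v j i)) = (\<Sum>j<k. (\<Sum>i\<in>T j. f i (u i)) + (\<Sum>i\<in>R j. f i (u i)))"
      using sum_v f by (intro sum.cong) auto
    also have "\<dots> = m * ((\<Sum>i\<in>A. f i (u i)) + (\<Sum>i\<in>S. f i (u i)))"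
      by (simp add: sum.distrib T(3) R(3) algebra_simps)
    also have "(\<Sum>i\<in>A. f i (u i)) + (\<Sum>i\<in>S. f i (u i)) = (\<Sum>i\<in>A \<union> S. f i (u i))"
      using A(1) finS disj by (simp add: sum.union_disjoint)
    also have "\<dots> = (\<Sum>i<p. f i (u i))"
      using A(3) S(2) f \<beta>0 \<beta>s0 by (intro sum.mono_neutral_left) (auto simp: u_def)
    finally show ?thesis .
  qed
  define y where "y i = response p X W \<beta>s i - mat_vec p X \<beta> i" for i
  have y: "y i = W i + mat_vec p X u i" for i
    by (simp add: y_def response_def u_def mat_vec_def sum_subtractf algebra_simps)
  define s where "s = L2_set u {..<p}"
  define D where "D = L2_set (mat_vec p X u) {..<n}"
  have card_u: "card (support p u) \<le> 2 * k"
  proof -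
    have "support p u \<subseteq> A \<union> S" using \<beta>0 \<beta>s0 by (fastforce simp: support_def u_def)
    then have "card (support p u) \<le> card (A \<union> S)" using A finS by (intro card_mono) auto
    also have "\<dots> \<le> 2 * k" using card_Un_le[of A S] A S by simp
    finally show ?thesis .
  qed
  have card_v: "card (support p (v j)) \<le> 2 * k" if "j < k" for j
  proof -
    have "support p (v j) \<subseteq> T j \<union> R j" by (auto simp: support_def v_def)
    then have "card (support p (v j)) \<le> card (T j \<union> R j)" using TR[OF that] by (intro card_mono) auto
    also have "\<dots> \<le> 2 * k" using card_Un_le[of "T j" "R j"] T(2)[OF that] R(2)[OF that] m by simp
    finally show ?thesis .
  qed
  have s_ge: "sqrt k \<le> s"
  proof -
    have "real k = (\<Sum>i\<in>A. 1)" using A by simp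
    also have "\<dots> \<le> (\<Sum>i\<in>A. (u i)\<^sup>2)"
    proof (rule sum_mono)
      fix i assume i: "i \<in> A"
      then have "u i = \<beta>s i" using \<beta>0 A(3) disj by (auto simp: u_def)
      moreover have "1 \<le> \<bar>\<beta>s i\<bar>" using \<beta>s(2) i by (simp add: A_def)
      ultimately show "1 \<le> (u i)\<^sup>2" by (metis one_le_power power2_abs)
    qed
    also have "\<dots> \<le> (\<Sum>i<p. (u i)\<^sup>2)" using A by (intro sum_mono2) auto
    finally show ?thesis by (simp add: s_def L2_set_def)
  qed
  have D: "21 / 25 * (N * s) \<le> D" using lower[OF card_u] by (simp add: D_def s_def)
  have W': "L2_set W {..<n} \<le> 1 / 10 * (N * s)"
    using W mult_left_mono[OF s_ge N] by simp
  have inner: "D\<^sup>2 - L2_set W {..<n} * D \<le> (\<Sum>i<n. y i * mat_vec p X u i)"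
  proof -
    have "- (\<Sum>i<n. W i * mat_vec p X u i) \<le> (\<Sum>i<n. \<bar>W i\<bar> * \<bar>mat_vec p X u i\<bar>)"
      unfolding sum_negf[symmetric] by (intro sum_mono) (simp add: abs_mult[symmetric])
    also have "\<dots> \<le> L2_set W {..<n} * D" unfolding D_def by (rule L2_set_mult_ineq)
    finally show ?thesis
      by (simp add: y D_def L2_set_power2 distrib_right sum.distrib) (simp add: power2_eq_square)
  qed
  have key: "(21 / 19)\<^sup>2 * (N * s)\<^sup>2 \<le> 2 * (\<Sum>i<n. y i * mat_vec p X u i)"
  proof -
    have Ns: "0 \<le> N * s" using N by (simp add: s_def)
    have "(21 / 25 * (N * s)) * (37 / 50 * (N * s)) \<le> D * (D - L2_set W {..<n})"
      using D W' Ns by (intro mult_mono) auto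
    moreover have "(21 / 19)\<^sup>2 * (N * s)\<^sup>2 \<le> 2 * ((21 / 25 * (N * s)) * (37 / 50 * (N * s)))"
    proof -
      have "(21 / 19)\<^sup>2 * (N * s)\<^sup>2 \<le> (1554 / 1250) * (N * s)\<^sup>2"
        by (intro mult_right_mono) (simp_all add: power2_eq_square)
      also have "\<dots> = 2 * ((21 / 25 * (N * s)) * (37 / 50 * (N * s)))"
        by (simp add: power2_eq_square)
      finally show ?thesis .
    qed
    ultimately show ?thesis using inner by (simp add: power2_eq_square algebra_simps)
  qed
  have Xv: "(\<Sum>j<k. \<Sum>i<n. (mat_vec p X (v j) i)\<^sup>2) \<le> m * ((21 / 19)\<^sup>2 * (N * s)\<^sup>2)"
  proof -
    have "(\<Sum>i<n. (mat_vec p X (v j) i)\<^sup>2) \<le> (21 / 19 * N)\<^sup>2 * (\<Sum>i<p. (v j i)\<^sup>2)" if "j < k" for j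
    proof -
      have "(L2_set (mat_vec p X (v j)) {..<n})\<^sup>2 \<le> (21 / 19 * N * L2_set (v j) {..<p})\<^sup>2"
        using upper[OF card_v[OF that]] by (intro power_mono) auto
      then show ?thesis by (simp only: power_mult_distrib L2_set_power2)
    qed
    then have "(\<Sum>j<k. \<Sum>i<n. (mat_vec p X (v j) i)\<^sup>2) \<le> (\<Sum>j<k. (21 / 19 * N)\<^sup>2 * (\<Sum>i<p. (v j i)\<^sup>2))"
      by (intro sum_mono) auto
    also have "\<dots> = (21 / 19 * N)\<^sup>2 * (m * (\<Sum>i<p. (u i)\<^sup>2))"
      using avg[of "\<lambda>_ x. x\<^sup>2"] by (simp add: sum_distrib_left[symmetric])
    also have "\<dots> = m * ((21 / 19)\<^sup>2 * (N * s)\<^sup>2)"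
      by (simp add: s_def L2_set_power2 power_mult_distrib power_divide)
    finally show ?thesis .
  qed
  have Xv1: "(\<Sum>j<k. mat_vec p X (v j) i) = m * mat_vec p X u i" for i
    unfolding mat_vec_def by (rule avg) simp
  have "(\<Sum>j<k. \<Sum>i<n. (y i - mat_vec p X (v j) i)\<^sup>2) =
      (\<Sum>j<k. (\<Sum>i<n. (y i)\<^sup>2) + (\<Sum>i<n. (mat_vec p X (v j) i)\<^sup>2)
        - 2 * (\<Sum>i<n. y i * mat_vec p X (v j) i))"
    by (intro sum.cong) (simp_all add: power2_diff sum.distrib sum_subtractf sum_distrib_left mult.assoc)
  also have "\<dots> = k * (\<Sum>i<n. (y i)\<^sup>2) + (\<Sum>j<k. \<Sum>i<n. (mat_vec p X (v j) i)\<^sup>2)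
        - 2 * (\<Sum>j<k. \<Sum>i<n. y i * mat_vec p X (v j) i)"
    by (simp add: sum.distrib sum_subtractf sum_distrib_left)
  also have "(\<Sum>j<k. \<Sum>i<n. y i * mat_vec p X (v j) i) = (\<Sum>i<n. y i * (\<Sum>j<k. mat_vec p X (v j) i))"
    by (subst sum.swap) (simp add: sum_distrib_left)
  also have "\<dots> = m * (\<Sum>i<n. y i * mat_vec p X u i)"
    by (simp add: Xv1 sum_distrib_left mult_ac)
  finally have total: "(\<Sum>j<k. \<Sum>i<n. (y i - mat_vec p X (v j) i)\<^sup>2) \<le> k * (\<Sum>i<n. (y i)\<^sup>2)"
    using Xv mult_left_mono[OF key, of "real m"] by simp
  have "\<exists>j<k. (\<Sum>i<n. (y i - mat_vec p X (v j) i)\<^sup>2) \<le> (\<Sum>i<n. (y i)\<^sup>2)"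
  proof (rule ccontr)
    assume "\<not> ?thesis"
    then have "(\<Sum>j<k. \<Sum>i<n. (y i)\<^sup>2) < (\<Sum>j<k. \<Sum>i<n. (y i - mat_vec p X (v j) i)\<^sup>2)"
      using k by (intro sum_strict_mono[of "{..<k}" "\<lambda>_. \<Sum>i<n. (y i)\<^sup>2"]) (auto simp: not_le)
    then show False using total by simp
  qed
  then obtain j where j: "j < k" "(\<Sum>i<n. (y i - mat_vec p X (v j) i)\<^sup>2) \<le> (\<Sum>i<n. (y i)\<^sup>2)" by auto
  define \<beta>' where "\<beta>' i = \<beta> i + v j i" for i
  have \<beta>': "\<beta>' i = (if i \<in> T j then \<beta>s i else if i \<in> R j then 0 else \<beta> i)" if "i < p" for i
    using that T(1)[OF j(1)] R(1)[OF j(1)] disj \<beta>0[OF that] \<beta>s0[OF that]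
    by (auto simp: \<beta>'_def v_def u_def)
  have "support p \<beta>' \<subseteq> T j \<union> (S - R j)"
    using \<beta>0 by (fastforce simp: support_def \<beta>' split: if_splits)
  then have "card (support p \<beta>') \<le> card (T j \<union> (S - R j))"
    using TR[OF j(1)] finS by (intro card_mono) auto
  also have "\<dots> \<le> card (T j) + card (S - R j)" by (rule card_Un_le)
  also have "card (S - R j) = k - m"
    using R(1,2)[OF j(1)] TR[OF j(1)] S by (simp add: card_Diff_subset)
  finally have sp: "sparse p k \<beta>'" using T(2)[OF j(1)] m by (simp add: sparse_def)
  have "support p \<beta>' \<inter> A = T j"
  proof -
    have "\<beta> i = 0" if "i \<in> A" for i using \<beta>0 A(3) disj that by blast
    then show ?thesis using T(1)[OF j(1)] by (auto simp: support_def \<beta>' A_def split: if_splits)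
  qed
  then have ov: "overlap p \<beta>' \<beta>s = m" using T(2)[OF j(1)] by (simp add: overlap_def A_def)
  have "mat_vec p X \<beta>' i = mat_vec p X \<beta> i + mat_vec p X (v j) i" for i
    by (simp add: mat_vec_def \<beta>'_def algebra_simps sum.distrib)
  then have "residual n p X (response p X W \<beta>s) \<beta>' = L2_set (\<lambda>i. y i - mat_vec p X (v j) i) {..<n}"
    by (simp add: residual_def y_def algebra_simps)
  also have "\<dots> \<le> L2_set y {..<n}" using j(2) by (simp add: L2_set_def)
  also have "\<dots> = residual n p X (response p X W \<beta>s) \<beta>" by (simp add: residual_def y_def L2_set_def)
  finally show ?thesis using sp ov by blast
qed

section \<open>Measurability of the overlap gap property\<close>

text \<open>
  Coordinates outside \<open>{..<p}\<close> are fixed at \<^const>\<open>undefined\<close>, which keeps the set countable;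
  supports and residuals do not see them.
\<close>

definition rational_vectors :: "nat \<Rightarrow> (nat \<Rightarrow> real) set" where
  "rational_vectors p = (\<Pi>\<^sub>E i\<in>{..<p}. \<rat>)"

lemma countable_rational_vectors: "countable (rational_vectors p)"
  unfolding rational_vectors_def by (intro countable_PiE) (auto simp: countable_rat)

text \<open>
  The residual is continuous in \<open>\<beta>\<close>, but the overlap is not, so the nonzero coordinates are
  approximated by nonzero rationals and the zero coordinates are left alone.
\<close>

lemma rational_approximation_keeping_support:
  assumes "residual n p X Y \<beta> < r"
  obtains \<beta>' where "\<beta>' \<in> rational_vectors p" "support p \<beta>' = support p \<beta>" "residual n p X Y \<beta>' < r"
proof -
  have "\<exists>q\<in>\<rat>. (q = 0 \<longleftrightarrow> x = 0) \<and> \<bar>q - x\<bar> < 1 / real (Suc l)" for x :: real and l :: nat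
  proof (cases x "0 :: real" rule: linorder_cases)
    case less
    have "x - 1 / real (Suc l) < x" by simp
    then obtain q where "q \<in> \<rat>" "x - 1 / real (Suc l) < q" "q < x"
      using Rats_dense_in_real by blast
    then show ?thesis using less by (intro bexI[of _ q]) (simp_all add: abs_real_def)
  next
    case equal
    then show ?thesis by (intro bexI[of _ 0]) auto
  next
    case greater
    have "x < x + 1 / real (Suc l)" by simp
    then obtain q where "q \<in> \<rat>" "x < q" "q < x + 1 / real (Suc l)"
      using Rats_dense_in_real by blast
    then show ?thesis using greater by (intro bexI[of _ q]) (simp_all add: abs_real_def)
  qed
  then obtain q where q: "\<And>x l. q x l \<in> \<rat>" "\<And>x l. q x l = 0 \<longleftrightarrow> x = 0"
    "\<And>x l. \<bar>q x l - x\<bar> < 1 / real (Suc l)" by metis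
  have lim: "q x \<longlonglongrightarrow> x" for x :: real
  proof (rule LIM_zero_cancel, rule tendsto_rabs_zero_cancel)
    show "(\<lambda>l. \<bar>q x l - x\<bar>) \<longlonglongrightarrow> 0"
      by (rule tendsto_sandwich[OF _ _ tendsto_const LIMSEQ_Suc[OF lim_1_over_n]])
        (use q(3) in \<open>auto intro!: always_eventually less_imp_le simp del: of_nat_Suc\<close>)
  qed
  define b where "b l = (\<lambda>i\<in>{..<p}. q (\<beta> i) l)" for l
  have "(\<lambda>l. b l i) \<longlonglongrightarrow> \<beta> i" if "i < p" for i using lim that by (simp add: b_def)
  then have "(\<lambda>l. residual n p X Y (b l)) \<longlonglongrightarrow> residual n p X Y \<beta>"
    unfolding residual_def L2_set_def mat_vec_def by (intro tendsto_intros) auto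
  then have "eventually (\<lambda>l. residual n p X Y (b l) < r) sequentially"
    using assms by (rule order_tendstoD)
  then obtain l where "residual n p X Y (b l) < r" by (auto dest: eventually_happens)
  moreover have "b l \<in> rational_vectors p" using q(1) by (auto simp: b_def rational_vectors_def)
  moreover have "support p (b l) = support p \<beta>" using q(2) by (auto simp: b_def support_def)
  ultimately show ?thesis using that by blast
qed

text \<open>
  Quantifiers over the uncountably many vectors \<open>\<beta>\<close> and radii \<open>r\<close> do not obviously define a
  measurable event. All inequalities between residual and radius that are asserted to have a
  solution are strict, so rational vectors and radii suffice.
\<close>

lemma overlap_gap_property_iff_rational:
  fixes p :: nat and X :: "nat \<times> nat \<Rightarrow> real" and W \<beta>s :: "nat \<Rightarrow> real" and \<zeta>\<^sub>1 \<zeta>\<^sub>2 :: real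
  defines "Y \<equiv> response p X W \<beta>s"
  shows "(\<exists>r>0. overlap_gap_property n p k X W \<beta>s r \<zeta>\<^sub>1 \<zeta>\<^sub>2) \<longleftrightarrow>
    (\<exists>r\<in>\<rat>. residual n p X Y \<beta>s < r \<and>
      (\<exists>\<beta>\<in>rational_vectors p. (sparse p k \<beta> \<and> support p \<beta> \<inter> support p \<beta>s = {}) \<and> residual n p X Y \<beta> < r) \<and>
      (\<forall>\<beta>\<in>rational_vectors p. (sparse p k \<beta> \<and> \<zeta>\<^sub>1 * real k \<le> overlap p \<beta> \<beta>s \<and> overlap p \<beta> \<beta>s \<le> \<zeta>\<^sub>2 * real k)
        \<longrightarrow> r \<le> residual n p X Y \<beta>))"
    (is "?L \<longleftrightarrow> (\<exists>r\<in>\<rat>. ?R r)")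
proof
  assume ?L
  then obtain r \<beta> where r: "residual n p X Y \<beta>s < r" "sparse p k \<beta>" "support p \<beta> \<inter> support p \<beta>s = {}"
    "residual n p X Y \<beta> < r"
    "\<And>\<beta>. sparse p k \<beta> \<Longrightarrow> residual n p X Y \<beta> < r \<Longrightarrow>
      real (overlap p \<beta> \<beta>s) < \<zeta>\<^sub>1 * real k \<or> real (overlap p \<beta> \<beta>s) > \<zeta>\<^sub>2 * real k"
    unfolding overlap_gap_property_def Let_def Y_def by blast
  obtain r' where r': "r' \<in> \<rat>" "max (residual n p X Y \<beta>s) (residual n p X Y \<beta>) < r'" "r' < r"
    using Rats_dense_in_real[of "max (residual n p X Y \<beta>s) (residual n p X Y \<beta>)" r] r(1,4) by auto
  have "residual n p X Y \<beta> < r'" using r'(2) by simp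
  then obtain \<beta>' where \<beta>': "\<beta>' \<in> rational_vectors p" "support p \<beta>' = support p \<beta>" "residual n p X Y \<beta>' < r'"
    by (rule rational_approximation_keeping_support)
  have "?R r'"
  proof (intro conjI ballI impI)
    show "residual n p X Y \<beta>s < r'" using r'(2) by simp
    show "\<exists>\<beta>\<in>rational_vectors p. (sparse p k \<beta> \<and> support p \<beta> \<inter> support p \<beta>s = {}) \<and> residual n p X Y \<beta> < r'"
      using \<beta>' r(2,3) by (intro bexI[of _ \<beta>']) (auto simp: sparse_def)
  next
    fix b assume "sparse p k b \<and> \<zeta>\<^sub>1 * real k \<le> overlap p b \<beta>s \<and> overlap p b \<beta>s \<le> \<zeta>\<^sub>2 * real k"
    then show "r' \<le> residual n p X Y b" using r(5)[of b] r'(3) by linarith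
  qed
  then show "\<exists>r\<in>\<rat>. ?R r" using r'(1) by blast
next
  assume "\<exists>r\<in>\<rat>. ?R r"
  then obtain r where r: "?R r" by blast
  have "0 < r" using r L2_set_nonneg unfolding residual_def by (meson le_less_trans)
  moreover have "overlap_gap_property n p k X W \<beta>s r \<zeta>\<^sub>1 \<zeta>\<^sub>2"
    unfolding overlap_gap_property_def Let_def Y_def[symmetric]
  proof (intro conjI allI impI)
    show "residual n p X Y \<beta>s < r" using r by blast
    show "\<exists>\<beta>. sparse p k \<beta> \<and> support p \<beta> \<inter> support p \<beta>s = {} \<and> residual n p X Y \<beta> < r" using r by blast
  next
    fix b assume b: "sparse p k b \<and> residual n p X Y b < r"
    then obtain b' where b': "b' \<in> rational_vectors p" "support p b' = support p b" "residual n p X Y b' < r"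
      using rational_approximation_keeping_support by metis
    have "sparse p k b'" "overlap p b' \<beta>s = overlap p b \<beta>s"
      using b b' by (auto simp: sparse_def overlap_def)
    then show "real (overlap p b \<beta>s) < \<zeta>\<^sub>1 * real k \<or> real (overlap p b \<beta>s) > \<zeta>\<^sub>2 * real k"
      using r b' by (metis not_le)
  qed
  ultimately show ?L by blast
qed

lemma measurable_mat_vec:
  "i < n \<Longrightarrow> (\<lambda>X. mat_vec p X \<beta> i) \<in> borel_measurable (\<Pi>\<^sub>M _\<in>{..<n} \<times> {..<p}. density lborel (normal_density 0 s))"
proof -
  assume i: "i < n"
  have "(\<lambda>X. X q) \<in> borel_measurable (\<Pi>\<^sub>M _\<in>{..<n} \<times> {..<p}. density lborel (normal_density 0 s))"
    if "q \<in> {..<n} \<times> {..<p}" for q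
    using measurable_component_singleton[OF that, of "\<lambda>_. density lborel (normal_density 0 s)"] by simp
  then show ?thesis unfolding mat_vec_def using i by (intro borel_measurable_sum borel_measurable_times) auto
qed

lemma measurable_residual:
  "(\<lambda>\<omega>. residual n p (fst \<omega>) (response p (fst \<omega>) (snd \<omega>) \<beta>s) \<beta>) \<in> borel_measurable (model_law n p \<sigma>)"
proof -
  have X: "(\<lambda>\<omega>. mat_vec p (fst \<omega>) b i) \<in> borel_measurable (model_law n p \<sigma>)" if "i < n" for b i
    unfolding model_law_def
    by (rule measurable_compose[OF measurable_fst measurable_mat_vec]) (fact that)
  have W: "(\<lambda>\<omega>. snd \<omega> i) \<in> borel_measurable (model_law n p \<sigma>)" if "i < n" for i
    unfolding model_law_def
  proof (rule measurable_compose[OF measurable_snd])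
    show "(\<lambda>W. W i) \<in> borel_measurable (\<Pi>\<^sub>M _\<in>{..<n}. density lborel (normal_density 0 \<sigma>))"
      using measurable_component_singleton[of i "{..<n}" "\<lambda>_. density lborel (normal_density 0 \<sigma>)"] that by simp
  qed
  show ?thesis
    unfolding residual_def L2_set_def response_def
    by (intro measurable_compose[OF _ borel_measurable_sqrt] borel_measurable_sum borel_measurable_power borel_measurable_diff
        borel_measurable_add X W) auto
qed

lemma sets_no_overlap_gap:
  "{(X, W) \<in> space (model_law n p \<sigma>). \<not> (\<exists>r > 0. overlap_gap_property n p k X W \<beta>s r \<zeta>\<^sub>1 \<zeta>\<^sub>2)}
    \<in> sets (model_law n p \<sigma>)"
proof -
  let ?f = "\<lambda>\<beta> \<omega>. residual n p (fst \<omega>) (response p (fst \<omega>) (snd \<omega>) \<beta>s) \<beta>"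
  have less: "Measurable.pred (model_law n p \<sigma>) (\<lambda>\<omega>. ?f \<beta> \<omega> < r)" for \<beta> r
    by (rule borel_measurable_pred_less[OF measurable_residual borel_measurable_const])
  have le: "Measurable.pred (model_law n p \<sigma>) (\<lambda>\<omega>. r \<le> ?f \<beta> \<omega>)" for \<beta> r
    using pred_intros_logic(2)[OF less] by (simp only: not_less)
  have const: "Measurable.pred (model_law n p \<sigma>) (\<lambda>\<omega>. c)" for c
    by simp
  have "Measurable.pred (model_law n p \<sigma>)
    (\<lambda>\<omega>. \<not> (\<exists>r>0. overlap_gap_property n p k (fst \<omega>) (snd \<omega>) \<beta>s r \<zeta>\<^sub>1 \<zeta>\<^sub>2))"
    unfolding overlap_gap_property_iff_rational
    by (rule pred_intros_logic(2), rule measurable_pred_countable(2)[OF countable_rat],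
        rule pred_intros_logic(3)[OF less pred_intros_logic(3)],
        rule measurable_pred_countable(2)[OF countable_rational_vectors],
        rule pred_intros_logic(3)[OF const less],
        rule measurable_pred_countable(1)[OF countable_rational_vectors],
        rule pred_intros_logic(4)[OF const le])
  then show ?thesis by (simp add: pred_def case_prod_beta')
qed

section \<open>Gaussian designs and Gaussian noise\<close>

abbreviation iid_normal :: "'a set \<Rightarrow> real \<Rightarrow> ('a \<Rightarrow> real) measure" where
  "iid_normal I s \<equiv> (\<Pi>\<^sub>M _\<in>I. density lborel (normal_density 0 s))"

lemma iid_normal_coordinates:
  assumes s: "0 < s"
  shows "prob_space (iid_normal I s)"
    and "i \<in> I \<Longrightarrow> distributed (iid_normal I s) lborel (\<lambda>\<omega>. \<omega> i) (normal_density 0 s)"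
    and "I \<noteq> {} \<Longrightarrow> prob_space.indep_vars (iid_normal I s) (\<lambda>_. borel) (\<lambda>i \<omega>. \<omega> i) I"
proof -
  let ?N = "density lborel (normal_density 0 s)"
  let ?P = "iid_normal I s"
  have N: "prob_space ?N" using s by (rule prob_space_normal_density)
  show P: "prob_space ?P" using N by (rule prob_space_PiM)
  have comp: "distr ?P borel (\<lambda>\<omega>. \<omega> i) = ?N" if "i \<in> I" for i
  proof -
    have "distr ?P borel (\<lambda>\<omega>. \<omega> i) = distr ?P ?N (\<lambda>\<omega>. \<omega> i)" by (rule distr_cong) simp_all
    also have "\<dots> = ?N" by (rule distr_PiM_component[OF N that])
    finally show ?thesis .
  qed
  have meas: "(\<lambda>\<omega>. \<omega> i) \<in> borel_measurable ?P" if "i \<in> I" for i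
    using measurable_component_singleton[OF that, of "\<lambda>_. ?N"] by simp
  show "distributed ?P lborel (\<lambda>\<omega>. \<omega> i) (normal_density 0 s)" if "i \<in> I"
  proof -
    have "distr ?P lborel (\<lambda>\<omega>. \<omega> i) = distr ?P borel (\<lambda>\<omega>. \<omega> i)" by (rule distr_cong) simp_all
    then show ?thesis using comp[OF that] meas[OF that] by (simp add: distributed_def)
  qed
  show "prob_space.indep_vars ?P (\<lambda>_. borel) (\<lambda>i \<omega>. \<omega> i) I" if "I \<noteq> {}"
  proof -
    interpret prob_space ?P by (rule P)
    have "distr ?P (\<Pi>\<^sub>M i\<in>I. borel) (\<lambda>\<omega>. \<lambda>i\<in>I. \<omega> i) = distr ?P (\<Pi>\<^sub>M i\<in>I. borel) (\<lambda>\<omega>. \<omega>)"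
      by (rule distr_cong) (auto simp: space_PiM PiE_def extensional_restrict)
    also have "\<dots> = ?P" by (rule distr_id2) (auto intro!: sets_PiM_cong)
    also have "\<dots> = (\<Pi>\<^sub>M i\<in>I. distr ?P borel (\<lambda>\<omega>. \<omega> i))"
      by (rule PiM_cong) (simp_all add: comp)
    finally show ?thesis
      using that meas by (subst indep_vars_iff_distr_eq_PiM') auto
  qed
qed

text \<open>
  The coordinates of \<open>X z\<close> involve disjoint rows of \<open>X\<close>, hence are independent, and each is a linear
  combination of independent standard normal variables.
\<close>

lemma mat_vec_iid_normal:
  assumes n: "0 < n" and z: "0 < L2_set z {..<p}"
  shows "prob_space.indep_vars (iid_normal ({..<n} \<times> {..<p}) 1) (\<lambda>_. borel) (\<lambda>i X. mat_vec p X z i) {..<n}"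
    and "i < n \<Longrightarrow> distributed (iid_normal ({..<n} \<times> {..<p}) 1) lborel (\<lambda>X. mat_vec p X z i)
      (normal_density 0 (L2_set z {..<p}))"
proof -
  let ?P = "iid_normal ({..<n} \<times> {..<p}) (1 :: real)"
  interpret prob_space ?P by (rule iid_normal_coordinates) simp
  \<comment> \<open>Terms with \<open>z j = 0\<close> have no density and are left out of the sum of normal variables.\<close>
  define J where "J = {j. j < p \<and> z j \<noteq> 0}"
  have "J \<noteq> {}"
  proof
    assume "J = {}"
    then have "L2_set z {..<p} = 0" by (intro L2_set_0') (auto simp: J_def)
    then show False using z by simp
  qed
  then have ne: "{..<n} \<times> {..<p} \<noteq> {}" using n by (auto simp: J_def)
  have ind: "indep_vars (\<lambda>_. borel) (\<lambda>q \<omega>. \<omega> q) ({..<n} \<times> {..<p})"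
    using ne by (intro iid_normal_coordinates) auto
  show "indep_vars (\<lambda>_. borel) (\<lambda>i X. mat_vec p X z i) {..<n}"
  proof -
    have "indep_vars (\<lambda>i. \<Pi>\<^sub>M q\<in>{i} \<times> {..<p}. borel) (\<lambda>i X. restrict (\<lambda>q. X q) ({i} \<times> {..<p})) {..<n}"
      by (rule indep_vars_restrict[OF ind]) (auto simp: disjoint_family_on_def)
    then have "indep_vars (\<lambda>_. borel)
        (\<lambda>i X. \<Sum>j<p. restrict (\<lambda>q. X q) ({i} \<times> {..<p}) (i, j) * z j) {..<n}"
      by (rule indep_vars_compose2) (auto intro!: borel_measurable_sum borel_measurable_times measurable_component_singleton)
    then show ?thesis by (simp add: mat_vec_def)
  qed
  show "distributed ?P lborel (\<lambda>X. mat_vec p X z i) (normal_density 0 (L2_set z {..<p}))" if i: "i < n"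
  proof -
    have sub: "{i} \<times> J \<subseteq> {..<n} \<times> {..<p}" using i by (auto simp: J_def)
    have "indep_vars (\<lambda>_. borel) (\<lambda>q X. X q * z (snd q)) ({i} \<times> J)"
      by (rule indep_vars_compose2[OF indep_vars_subset[OF ind sub]]) simp
    moreover have "distributed ?P lborel (\<lambda>X. X q * z (snd q)) (normal_density 0 \<bar>z (snd q)\<bar>)"
      if "q \<in> {i} \<times> J" for q
    proof -
      have "distributed ?P lborel (\<lambda>X. X q) (normal_density 0 1)"
        using that sub by (intro iid_normal_coordinates) auto
      from normal_density_affine[OF this, of "z (snd q)" 0] show ?thesis
        using that by (auto simp: J_def mult.commute)
    qed
    ultimately have "distributed ?P lborel (\<lambda>X. \<Sum>q\<in>{i} \<times> J. X q * z (snd q))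
        (normal_density (\<Sum>q\<in>{i} \<times> J. 0) (sqrt (\<Sum>q\<in>{i} \<times> J. \<bar>z (snd q)\<bar>\<^sup>2)))"
      using \<open>J \<noteq> {}\<close> by (intro sum_indep_normal) (auto simp: J_def)
    moreover have "(\<Sum>q\<in>{i} \<times> J. X q * z (snd q)) = mat_vec p X z i" for X
    proof -
      have "(\<Sum>q\<in>{i} \<times> J. X q * z (snd q)) = (\<Sum>j\<in>J. X (i, j) * z j)"
        by (rule sum.reindex_bij_witness[of _ "\<lambda>j. (i, j)" snd]) auto
      also have "\<dots> = mat_vec p X z i"
        unfolding mat_vec_def by (rule sum.mono_neutral_left) (auto simp: J_def)
      finally show ?thesis .
    qed
    moreover have "(\<Sum>q\<in>{i} \<times> J. \<bar>z (snd q)\<bar>\<^sup>2) = (\<Sum>j<p. (z j)\<^sup>2)"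
    proof -
      have "(\<Sum>q\<in>{i} \<times> J. \<bar>z (snd q)\<bar>\<^sup>2) = (\<Sum>j\<in>J. (z j)\<^sup>2)"
        by (rule sum.reindex_bij_witness[of _ "\<lambda>j. (i, j)" snd]) auto
      also have "\<dots> = (\<Sum>j<p. (z j)\<^sup>2)"
        by (rule sum.mono_neutral_left) (auto simp: J_def)
      finally show ?thesis .
    qed
    ultimately show ?thesis by (simp add: L2_set_def)
  qed
qed

text \<open>
  The tail bounds with \<open>\<delta> = 1 / 10\<close>; then \<open>1 + \<delta> \<le> (21 / 20)\<^sup>2\<close> and \<open>(18 / 19)\<^sup>2 \<le> 1 - \<delta>\<close>.
\<close>

lemma mat_vec_norm_concentration:
  assumes n: "0 < n" 
  shows "measure (iid_normal ({..<n} \<times> {..<p}) 1) {X \<in> space (iid_normal ({..<n} \<times> {..<p}) 1).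
      \<not> (18 / 19 * sqrt n * L2_set z {..<p} \<le> L2_set (mat_vec p X z) {..<n} \<and>
         L2_set (mat_vec p X z) {..<n} \<le> 21 / 20 * sqrt n * L2_set z {..<p})} \<le> 2 * exp (- (real n / 1600))"
    (is "measure ?P ?B \<le> _")
proof (cases "0 < L2_set z {..<p}")
  case False
  then have "L2_set z {..<p} = 0" using L2_set_nonneg[of z "{..<p}"] by linarith
  moreover from this have "L2_set (mat_vec p X z) {..<n} = 0" for X
    using L2_set_mat_vec_le[of p X z n] L2_set_nonneg[of "mat_vec p X z" "{..<n}"] by simp
  ultimately have "?B = {}" by simp
  then show ?thesis by (simp only: measure_empty) simp
next
  case True
  interpret prob_space ?P by (rule iid_normal_coordinates) simp
  define s where "s = L2_set z {..<p}"
  have s: "0 < s" using True by (simp add: s_def)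
  let ?S = "\<lambda>X. \<Sum>i<n. (mat_vec p X z i)\<^sup>2"
  let ?U = "{X \<in> space ?P. (1 + 1 / 10) * s\<^sup>2 * real (card {..<n}) \<le> ?S X}"
  let ?L = "{X \<in> space ?P. ?S X \<le> (1 - 1 / 10) * s\<^sup>2 * real (card {..<n})}"
  note rows = mat_vec_iid_normal[OF n True, folded s_def]
  have [measurable]: "?S \<in> borel_measurable ?P"
    by (intro borel_measurable_sum borel_measurable_power measurable_mat_vec) auto
  have U: "prob ?U \<le> exp (- (real n / 1600))"
    using sum_squares_normal_upper_tail[OF _ rows(1) s, of "1 / 10"] rows(2)
    by (simp add: power2_eq_square)
  have L: "prob ?L \<le> exp (- (real n / 1600))"
    using sum_squares_normal_lower_tail[OF _ rows(1) s, of "1 / 10"] rows(2)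
    by (simp add: power2_eq_square)
  have "?B \<subseteq> ?U \<union> ?L"
  proof
    fix X assume X: "X \<in> ?B"
    let ?x = "L2_set (mat_vec p X z) {..<n}"
    have sq: "(a * sqrt n * s)\<^sup>2 = a\<^sup>2 * s\<^sup>2 * n" for a by (simp add: power_mult_distrib)
    consider "?x < 18 / 19 * sqrt n * s" | "21 / 20 * sqrt n * s < ?x"
      using X by (auto simp: s_def not_le)
    then show "X \<in> ?U \<union> ?L"
    proof cases
      case 1
      then have "?x\<^sup>2 \<le> (18 / 19 * sqrt n * s)\<^sup>2" by (intro power_mono) auto
      also have "\<dots> \<le> (1 - 1 / 10) * s\<^sup>2 * n"
        unfolding sq by (intro mult_right_mono) (simp_all add: power2_eq_square)
      finally show ?thesis using X by (simp add: L2_set_power2)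
    next
      case 2
      have "(1 + 1 / 10) * s\<^sup>2 * n \<le> (21 / 20 * sqrt n * s)\<^sup>2"
        unfolding sq by (intro mult_right_mono) (simp_all add: power2_eq_square)
      also have "\<dots> \<le> ?x\<^sup>2" using 2 s by (intro power_mono) auto
      finally show ?thesis using X by (simp add: L2_set_power2)
    qed
  qed
  then have "prob ?B \<le> prob (?U \<union> ?L)" by (intro finite_measure_mono) measurable
  also have "\<dots> \<le> prob ?U + prob ?L" by (intro measure_Un_le) measurable
  finally show ?thesis using U L by simp
qed

lemma lattice_near_isometry_prob:
  fixes n p d :: nat
  assumes n: "0 < n"
  defines "P \<equiv> iid_normal ({..<n} \<times> {..<p}) (1 :: real)"
  shows "{X \<in> space P. \<not> lattice_near_isometry n p d X (sqrt n)} \<in> sets P" (is "?B \<in> _")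
    and "measure P {X \<in> space P. \<not> lattice_near_isometry n p d X (sqrt n)}
      \<le> (2 * p + 1) ^ (400 * d) * (2 * exp (- (real n / 1600)))"
proof -
  interpret prob_space P unfolding P_def by (rule iid_normal_coordinates) simp
  define bad where "bad z = {X \<in> space P.
      \<not> (18 / 19 * sqrt n * L2_set z {..<p} \<le> L2_set (mat_vec p X z) {..<n} \<and>
         L2_set (mat_vec p X z) {..<n} \<le> 21 / 20 * sqrt n * L2_set z {..<p})}" for z
  let ?K = "l1_lattice_ball p (400 * d)"
  have K: "finite ?K" "card ?K \<le> (2 * p + 1) ^ (400 * d)" using card_l1_lattice_ball by auto
  have eq: "?B = (\<Union>z\<in>?K. bad (\<lambda>i. real_of_int (z i)))"
    by (auto simp: lattice_near_isometry_def bad_def)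
  have norm: "(\<lambda>X. L2_set (mat_vec p X z) {..<n}) \<in> borel_measurable P" for z
    unfolding L2_set_def P_def
    by (intro measurable_compose[OF _ borel_measurable_sqrt] borel_measurable_sum borel_measurable_power measurable_mat_vec) auto
  have bad: "bad z \<in> sets P" for z
  proof -
    note [measurable] = norm
    show ?thesis unfolding bad_def by measurable
  qed
  show "?B \<in> sets P" unfolding eq using K(1) bad by (intro sets.finite_UN) auto
  have "prob ?B \<le> (\<Sum>z\<in>?K. prob (bad (\<lambda>i. real_of_int (z i))))"
    unfolding eq using K(1) bad by (intro finite_measure_subadditive_finite) auto
  also have "\<dots> \<le> (\<Sum>z\<in>?K. 2 * exp (- (real n / 1600)))"
    using mat_vec_norm_concentration[OF n] by (intro sum_mono) (simp add: bad_def P_def)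
  also have "\<dots> = card ?K * (2 * exp (- (real n / 1600)))" by simp
  also have "\<dots> \<le> (2 * p + 1) ^ (400 * d) * (2 * exp (- (real n / 1600)))"
    using K(2) by (intro mult_right_mono) (simp_all only: of_nat_le_iff, simp)
  finally show "prob ?B \<le> (2 * p + 1) ^ (400 * d) * (2 * exp (- (real n / 1600)))" .
qed

lemma noise_norm_prob:
  fixes n :: nat and \<sigma> :: real
  assumes n: "0 < n" and \<sigma>: "0 < \<sigma>"
  defines "P \<equiv> iid_normal {..<n} \<sigma>"
  shows "{W \<in> space P. 2 * \<sigma>\<^sup>2 * real n \<le> (\<Sum>i<n. (W i)\<^sup>2)} \<in> sets P"
    and "measure P {W \<in> space P. 2 * \<sigma>\<^sup>2 * real n \<le> (\<Sum>i<n. (W i)\<^sup>2)} \<le> exp (- (real n / 16))"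
proof -
  interpret prob_space P unfolding P_def using \<sigma> by (rule iid_normal_coordinates)
  have "(\<lambda>W. W i) \<in> borel_measurable P" if "i < n" for i
    unfolding P_def using measurable_component_singleton[of i "{..<n}" "\<lambda>_. density lborel (normal_density 0 \<sigma>)"] that by simp
  then have "(\<lambda>W. \<Sum>i<n. (W i)\<^sup>2) \<in> borel_measurable P"
    by (intro borel_measurable_sum borel_measurable_power) auto
  then show "{W \<in> space P. 2 * \<sigma>\<^sup>2 * real n \<le> (\<Sum>i<n. (W i)\<^sup>2)} \<in> sets P" by measurable
  have "indep_vars (\<lambda>_. borel) (\<lambda>i W. W i) {..<n}"
    unfolding P_def using n \<sigma> by (intro iid_normal_coordinates) auto
  moreover have "distributed P lborel (\<lambda>W. W i) (normal_density 0 \<sigma>)" if "i \<in> {..<n}" for i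
    unfolding P_def using \<sigma> that by (intro iid_normal_coordinates) auto
  ultimately show "prob {W \<in> space P. 2 * \<sigma>\<^sup>2 * real n \<le> (\<Sum>i<n. (W i)\<^sup>2)} \<le> exp (- (real n / 16))"
    using sum_squares_normal_upper_tail[of "{..<n}" "\<lambda>i W. W i" \<sigma> 1] \<sigma> by simp
qed

section \<open>Absence of the overlap gap\<close>

text \<open>
  As \<open>\<zeta>\<^sub>1 k\<close> and \<open>\<zeta>\<^sub>2 k\<close> differ by at least 1, there is an integer \<open>m\<close> between them. The disjointly
  supported vector provided by the gap property is turned into one of overlap \<open>m\<close> whose residual
  is still below \<open>r\<close>, which the gap property forbids.
\<close>

lemma no_overlap_gap_if_near_isometry:
  fixes n p k :: nat and X :: "nat \<times> nat \<Rightarrow> real" and W \<beta>s :: "nat \<Rightarrow> real" and \<zeta>\<^sub>1 \<zeta>\<^sub>2 r :: real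
  assumes iso: "lattice_near_isometry n p (2 * k) X (sqrt n)"
    and W: "L2_set W {..<n} \<le> sqrt n * sqrt k / 10"
    and \<beta>s: "card (support p \<beta>s) = k" "\<And>i. i \<in> support p \<beta>s \<Longrightarrow> 1 \<le> \<bar>\<beta>s i\<bar>"
    and k: "0 < k" "2 * k \<le> p"
    and \<zeta>: "0 < \<zeta>\<^sub>1" "\<zeta>\<^sub>2 < 1" "1 \<le> (\<zeta>\<^sub>2 - \<zeta>\<^sub>1) * k"
  shows "\<not> overlap_gap_property n p k X W \<beta>s r \<zeta>\<^sub>1 \<zeta>\<^sub>2"
proof
  assume ogp: "overlap_gap_property n p k X W \<beta>s r \<zeta>\<^sub>1 \<zeta>\<^sub>2"
  then obtain \<beta> where \<beta>: "sparse p k \<beta>" "support p \<beta> \<inter> support p \<beta>s = {}"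
    "residual n p X (response p X W \<beta>s) \<beta> < r"
    by (auto simp: overlap_gap_property_def Let_def)
  define m where "m = nat \<lceil>\<zeta>\<^sub>1 * k\<rceil>"
  have "0 \<le> \<zeta>\<^sub>1 * k" using \<zeta> by simp
  then have "real m = of_int \<lceil>\<zeta>\<^sub>1 * k\<rceil>" by (simp add: m_def)
  then have m: "\<zeta>\<^sub>1 * k \<le> m" "m \<le> \<zeta>\<^sub>2 * k"
    using \<zeta>(3) ceiling_correct[of "\<zeta>\<^sub>1 * k"] by (simp_all add: left_diff_distrib)
  have "\<zeta>\<^sub>2 * k \<le> 1 * real k" using \<zeta>(2) by (intro mult_right_mono) auto
  then have mk: "m \<le> k" using m(2) by simp
  interpret lattice_near_isometry n p "2 * k" X "sqrt n" by (rule iso)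
  obtain \<beta>' where "sparse p k \<beta>'" "overlap p \<beta>' \<beta>s = m"
    "residual n p X (response p X W \<beta>s) \<beta>' \<le> residual n p X (response p X W \<beta>s) \<beta>"
    using exchange_step[OF N sparse_upper sparse_lower W \<beta>s k \<beta>(1,2) mk] by blast
  then show False
    using ogp \<beta>(3) m unfolding overlap_gap_property_def Let_def by force
qed

text \<open>
  For 2k-sparse vectors the union bound runs over at most \<open>(2 p + 1)\<^bsup>800 k\<^esup> \<le> p\<^bsup>1600 k\<^esup>\<close> lattice vectors,
  each of which fails with probability at most \<open>2 exp (- n / 1600)\<close>. The constant is
  \<open>2561600 = 1600 * 1601\<close>, which leaves a factor \<open>exp (- k ln p) \<le> exp (- k)\<close>.
\<close>

lemma lattice_union_bound:
  fixes n p k :: nat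
  assumes "3 * k \<le> p" "0 < k" "real n \<ge> 2561600 * real k * ln p"
  shows "real ((2 * p + 1) ^ (400 * (2 * k))) * (2 * exp (- (real n / 1600))) \<le> 2 * exp (- real k)"
    and "exp (- (real n / 16)) \<le> exp (- real k)"
proof -
  have p: "3 \<le> p" using assms by linarith
  have "1 \<le> ln (real p)" using p exp_le by (subst ln_ge_iff) auto
  then have kl: "real k \<le> k * ln p" using mult_left_mono[of 1 "ln (real p)" "real k"] by simp
  have "3 * p \<le> p * p" by (rule mult_le_mono1[OF p])
  then have "2 * p + 1 \<le> p\<^sup>2" using p unfolding power2_eq_square by linarith
  then have "real (2 * p + 1) \<le> real p ^ 2" by (metis of_nat_le_iff of_nat_power)
  also have "\<dots> = exp (2 * ln p)" using p by (simp add: exp_of_nat_mult[of 2, simplified])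
  finally have "real (2 * p + 1) ^ (800 * k) \<le> exp (2 * ln p) ^ (800 * k)"
    by (intro power_mono) auto
  also have "\<dots> = exp (1600 * (k * ln p))" by (simp add: exp_of_nat_mult[symmetric] mult_ac)
  finally have "real ((2 * p + 1) ^ (400 * (2 * k))) * exp (- (real n / 1600))
      \<le> exp (1600 * (k * ln p)) * exp (- (real n / 1600))"
    by (intro mult_right_mono) (simp_all add: mult.assoc[symmetric])
  also have "\<dots> = exp (1600 * (k * ln p) - real n / 1600)" by (simp add: exp_add[symmetric])
  also have "\<dots> \<le> exp (- real k)" using assms(3) kl by simp
  finally show "real ((2 * p + 1) ^ (400 * (2 * k))) * (2 * exp (- (real n / 1600))) \<le> 2 * exp (- real k)"
    by simp
  show "exp (- (real n / 16)) \<le> exp (- real k)" using assms(3) kl by simp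
qed

text \<open>
  With \<open>\<sigma>\<^sup>2 \<le> k / 200\<close>, the typical bound \<open>\<parallel>W\<parallel>\<^sup>2 \<le> 2 \<sigma>\<^sup>2 n\<close> implies the noise bound
  \<open>\<parallel>W\<parallel> \<le> \<surd>n \<surd>k / 10\<close> of the deterministic argument.
\<close>

lemma no_overlap_gap_prob:
  fixes n p k :: nat and \<sigma> :: real and \<beta>s :: "nat \<Rightarrow> real" and \<zeta>\<^sub>1 \<zeta>\<^sub>2 :: real
  assumes n: "0 < n" and \<sigma>: "0 < \<sigma>" "\<sigma>\<^sup>2 \<le> k / 200"
    and k: "0 < k" "3 * k \<le> p" and nk: "real n \<ge> 2561600 * real k * ln p"
    and \<beta>s: "card (support p \<beta>s) = k" "\<And>i. i \<in> support p \<beta>s \<Longrightarrow> 1 \<le> \<bar>\<beta>s i\<bar>"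
    and \<zeta>: "0 < \<zeta>\<^sub>1" "\<zeta>\<^sub>2 < 1" "1 \<le> (\<zeta>\<^sub>2 - \<zeta>\<^sub>1) * k"
  shows "measure (model_law n p \<sigma>)
    {(X, W) \<in> space (model_law n p \<sigma>). \<not> (\<exists>r > 0. overlap_gap_property n p k X W \<beta>s r \<zeta>\<^sub>1 \<zeta>\<^sub>2)}
    \<ge> 1 - 3 * exp (- real k)" (is "measure ?M ?G \<ge> _")
proof -
  let ?PX = "iid_normal ({..<n} \<times> {..<p}) (1 :: real)" and ?PW = "iid_normal {..<n} \<sigma>"
  have M: "?M = ?PX \<Otimes>\<^sub>M ?PW" by (simp add: model_law_def)
  interpret PX: prob_space ?PX by (rule iid_normal_coordinates) simp
  interpret PW: prob_space ?PW using \<sigma>(1) by (rule iid_normal_coordinates)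
  interpret prob_space ?M using \<sigma>(1) by (rule prob_space_model_law)
  let ?BX = "{X \<in> space ?PX. \<not> lattice_near_isometry n p (2 * k) X (sqrt n)}"
  let ?BW = "{W \<in> space ?PW. 2 * \<sigma>\<^sup>2 * real n \<le> (\<Sum>i<n. (W i)\<^sup>2)}"
  have BX: "?BX \<in> sets ?PX" "measure ?PX ?BX \<le> 2 * exp (- real k)"
    using lattice_near_isometry_prob[OF n, of p "2 * k"] lattice_union_bound(1)[OF k(2,1) nk] by auto
  have BW: "?BW \<in> sets ?PW" "measure ?PW ?BW \<le> exp (- real k)"
    using noise_norm_prob(1)[OF n \<sigma>(1)]
      order_trans[OF noise_norm_prob(2)[OF n \<sigma>(1)] lattice_union_bound(2)[OF k(2,1) nk]] .
  have times: "measure ?M (A \<times> B) = measure ?PX A * measure ?PW B"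
    if "A \<in> sets ?PX" "B \<in> sets ?PW" for A B
    using that unfolding M by (simp add: measure_def PW.emeasure_pair_measure_Times enn2real_mult)
  have space: "space ?M = space ?PX \<times> space ?PW" unfolding M by (rule space_pair_measure)
  have "space ?M - ?G \<subseteq> ?BX \<times> space ?PW \<union> space ?PX \<times> ?BW"
  proof
    fix \<omega> assume \<omega>: "\<omega> \<in> space ?M - ?G"
    obtain X W where XW: "\<omega> = (X, W)" by (cases \<omega>)
    show "\<omega> \<in> ?BX \<times> space ?PW \<union> space ?PX \<times> ?BW"
    proof (rule ccontr)
      assume nB: "\<not> ?thesis"
      then have iso: "lattice_near_isometry n p (2 * k) X (sqrt n)" using nB \<omega> XW space by auto
      have "(\<Sum>i<n. (W i)\<^sup>2) \<le> 2 * \<sigma>\<^sup>2 * real n" using nB \<omega> XW space by auto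
      also have "\<dots> \<le> 2 * (k / 200) * real n" using \<sigma>(2) by (intro mult_right_mono) auto
      also have "\<dots> = (sqrt n * sqrt k / 10)\<^sup>2" by (simp add: power_mult_distrib power_divide)
      finally have "(L2_set W {..<n})\<^sup>2 \<le> (sqrt n * sqrt k / 10)\<^sup>2" by (simp add: L2_set_power2)
      then have "L2_set W {..<n} \<le> sqrt n * sqrt k / 10" by (rule power2_le_imp_le) simp
      then show False
        using no_overlap_gap_if_near_isometry[OF iso _ \<beta>s k(1) _ \<zeta>] k(2) \<omega> XW by auto
    qed
  qed
  moreover have sets: "?BX \<times> space ?PW \<in> events" "space ?PX \<times> ?BW \<in> events"
    using BX(1) BW(1) unfolding M by (auto intro!: pair_measureI)
  ultimately have "prob (space ?M - ?G) \<le> prob (?BX \<times> space ?PW \<union> space ?PX \<times> ?BW)"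
    by (intro finite_measure_mono) auto
  also have "\<dots> \<le> prob (?BX \<times> space ?PW) + prob (space ?PX \<times> ?BW)"
    using sets by (intro measure_Un_le)
  also have "\<dots> = measure ?PX ?BX + measure ?PW ?BW"
    using BX(1) BW(1) by (simp add: times PX.prob_space PW.prob_space)
  finally show ?thesis
    using BX(2) BW(2) prob_compl[OF sets_no_overlap_gap[of n p \<sigma> k \<beta>s \<zeta>\<^sub>1 \<zeta>\<^sub>2]] by simp
qed

theorem theorem2p3:
  "\<exists>c C :: real. 0 < c \<and> 0 < C \<and>
    (\<forall>\<zeta>\<^sub>1 \<zeta>\<^sub>2 :: real. 0 < \<zeta>\<^sub>1 \<and> \<zeta>\<^sub>1 < \<zeta>\<^sub>2 \<and> \<zeta>\<^sub>2 < 1 \<longrightarrow>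
      (\<forall>\<epsilon> :: real. 0 < \<epsilon> \<longrightarrow>
        (\<exists>k\<^sub>0 :: nat. \<forall>(n :: nat) (p :: nat) (k :: nat) (\<sigma> :: real) (\<beta>s :: nat \<Rightarrow> real).
          0 < n \<and> 0 < p \<and> 0 < k \<and> 0 < \<sigma> \<and>
          real k \<le> real p / 3 \<and>
          \<sigma>\<^sup>2 \<le> c * min (real k) (ln (real p) / ln (ln (real p))) \<and>
          real n \<ge> C * real k * ln (real p) \<and>
          card (support p \<beta>s) = k \<and>
          abs_min p \<beta>s \<ge> 1 \<and>
          k \<ge> k\<^sub>0 \<longrightarrow>
            measure (model_law n p \<sigma>)
              {(X, W) \<in> space (model_law n p \<sigma>).
                \<not> (\<exists>r > 0. overlap_gap_property n p k X W \<beta>s r \<zeta>\<^sub>1 \<zeta>\<^sub>2)} \<ge> 1 - \<epsilon>)))"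
proof (rule exI[of _ "1 / 200"], rule exI[of _ 2561600], intro conjI allI impI)
  fix \<zeta>\<^sub>1 \<zeta>\<^sub>2 \<epsilon> :: real
  assume \<zeta>: "0 < \<zeta>\<^sub>1 \<and> \<zeta>\<^sub>1 < \<zeta>\<^sub>2 \<and> \<zeta>\<^sub>2 < 1" and \<epsilon>: "0 < \<epsilon>"
  define k\<^sub>0 where "k\<^sub>0 = nat \<lceil>max (1 / (\<zeta>\<^sub>2 - \<zeta>\<^sub>1)) (ln (3 / \<epsilon>))\<rceil>"
  show "\<exists>k\<^sub>0 :: nat. \<forall>(n :: nat) (p :: nat) (k :: nat) (\<sigma> :: real) (\<beta>s :: nat \<Rightarrow> real).
          0 < n \<and> 0 < p \<and> 0 < k \<and> 0 < \<sigma> \<and>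
          real k \<le> real p / 3 \<and>
          \<sigma>\<^sup>2 \<le> 1 / 200 * min (real k) (ln (real p) / ln (ln (real p))) \<and>
          real n \<ge> 2561600 * real k * ln (real p) \<and>
          card (support p \<beta>s) = k \<and>
          abs_min p \<beta>s \<ge> 1 \<and>
          k \<ge> k\<^sub>0 \<longrightarrow>
            measure (model_law n p \<sigma>)
              {(X, W) \<in> space (model_law n p \<sigma>).
                \<not> (\<exists>r > 0. overlap_gap_property n p k X W \<beta>s r \<zeta>\<^sub>1 \<zeta>\<^sub>2)} \<ge> 1 - \<epsilon>"
  proof (intro exI[of _ k\<^sub>0] allI impI)
    fix n p k :: nat and \<sigma> :: real and \<beta>s :: "nat \<Rightarrow> real"
    assume hyps: "0 < n \<and> 0 < p \<and> 0 < k \<and> 0 < \<sigma> \<and>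
          real k \<le> real p / 3 \<and>
          \<sigma>\<^sup>2 \<le> 1 / 200 * min (real k) (ln (real p) / ln (ln (real p))) \<and>
          real n \<ge> 2561600 * real k * ln (real p) \<and>
          card (support p \<beta>s) = k \<and>
          abs_min p \<beta>s \<ge> 1 \<and>
          k \<ge> k\<^sub>0"
    then have h: "0 < n" "0 < k" "0 < \<sigma>" "real k \<le> real p / 3"
      "\<sigma>\<^sup>2 \<le> 1 / 200 * min (real k) (ln (real p) / ln (ln (real p)))"
      "real n \<ge> 2561600 * real k * ln (real p)"
      "card (support p \<beta>s) = k" "abs_min p \<beta>s \<ge> 1" "k \<ge> k\<^sub>0"
      by blast+
    have kk: "1 / (\<zeta>\<^sub>2 - \<zeta>\<^sub>1) \<le> k" "ln (3 / \<epsilon>) \<le> k"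
      using h(9) unfolding k\<^sub>0_def by linarith+
    have gap: "1 \<le> (\<zeta>\<^sub>2 - \<zeta>\<^sub>1) * k" using kk(1) \<zeta> by (simp add: field_simps)
    have "exp (ln (3 / \<epsilon>)) \<le> exp (real k)" using kk(2) by simp
    then have "3 / \<epsilon> \<le> exp k" using \<epsilon> by simp
    then have eps: "3 * exp (- real k) \<le> \<epsilon>" using \<epsilon> by (simp add: exp_minus field_simps)
    have "\<sigma>\<^sup>2 \<le> k / 200" using h(5) by linarith
    moreover have "1 \<le> \<bar>\<beta>s i\<bar>" if "i \<in> support p \<beta>s" for i
    proof -
      have "abs_min p \<beta>s \<le> \<bar>\<beta>s i\<bar>"
        unfolding abs_min_def using that by (intro Min_le) (auto simp: support_def)
      then show ?thesis using h(8) by simp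
    qed
    moreover have "3 * k \<le> p" using h(4) by linarith
    ultimately have "1 - 3 * exp (- real k) \<le> measure (model_law n p \<sigma>)
        {(X, W) \<in> space (model_law n p \<sigma>). \<not> (\<exists>r > 0. overlap_gap_property n p k X W \<beta>s r \<zeta>\<^sub>1 \<zeta>\<^sub>2)}"
      using h \<zeta> gap by (intro no_overlap_gap_prob) auto
    then show "measure (model_law n p \<sigma>)
        {(X, W) \<in> space (model_law n p \<sigma>). \<not> (\<exists>r > 0. overlap_gap_property n p k X W \<beta>s r \<zeta>\<^sub>1 \<zeta>\<^sub>2)} \<ge> 1 - \<epsilon>"
      using eps by linarith
  qed
qed simp_all

end
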